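(* Let $(X,\mathcal{A},p)$ be an essentially standard Borel probability space. Consider the set of dagger idempotents on $(X,\mathcal{A},p)$ in $\mathsf{EKrn}$, i.e. a.s.-classes of measure-preserving kernels $e:(X,\mathcal{A},p)\to(X,\mathcal{A},p)$ with $e\circ e=e=e^+$ almost surely, partially ordered by $e\le f$ iff $e\circ f=f\circ e=e$ almost surely. Then: every increasing net $(e_\lambda)_{\lambda\in\Lambda}$ of such idempotents that is bounded above has a supremum $e$ in this order, and $e_\lambda\to e$ in the two-sided topology; and every decreasing net bounded below has an infimum $e$ and converges to it in the two-sided topology.
   Context: A Markov kernel $k:(X,\mathcal{A})\to(Y,\mathcal{B})$ assigns to $x\in X$, $B\in\mathcal{B}$ a number $k(B\mid x)\in[0,1]$, measurable in $x$ and a probability measure in $B$; composition is $(\ell\circ k)(C\mid x)=\int_Y\ell(C\mid y)\,k(dy\mid x)$. It is measure-preserving $(X,\mathcal{A},p)\to(Y,\mathcal{B},q)$ if $\int_X k(B\mid x)\,p(dx)=q(B)$ for all $B$; $k,h$ are $p$-a.s. equal if for each $B$, $k(B\mid x)=h(B\mid x)$ for $p$-a.a. $x$. $\mathsf{GKrn}$ is the category of probability spaces and a.s.-classes of measure-preserving kernels; a probability space is essentially standard Borel if isomorphic in $\mathsf{GKrn}$ to one with standard Borel underlying space, and $\mathsf{EKrn}$ is the corresponding full subcategory. The Bayesian inverse $k^+:(Y,\mathcal{B},q)\to(X,\mathcal{A},p)$ of $k$ is the (a.s. unique, existing in $\mathsf{EKrn}$) measure-preserving kernel with $\int_A k(B\mid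 x)\,p(dx)=\int_B k^+(A\mid y)\,q(dy)$ for all $A\in\mathcal{A},B\in\mathcal{B}$. A net $k_\lambda\to k$ in the one-sided topology iff $\int_X|k(B\mid x)-k_\lambda(B\mid x)|\,p(dx)\to0$ for all $B\in\mathcal{B}$; in the two-sided topology iff additionally $k_\lambda^+\to k^+$ in the one-sided topology. *)

theory Defs
  imports "HOL-Probability.Probability"
begin

text \<open>A Markov kernel from (space M, sets M) to (space N, sets N) is represented as a
  measurable map into the Giry probability algebra; k(B | x) = measure (k x) B.\<close>

definition markov_kernel :: "'a measure \<Rightarrow> 'b measure \<Rightarrow> ('a \<Rightarrow> 'b measure) \<Rightarrow> bool" where
  "markov_kernel M N k \<longleftrightarrow> k \<in> M \<rightarrow>\<^sub>M prob_algebra N"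

definition mp_kernel :: "'a measure \<Rightarrow> 'b measure \<Rightarrow> ('a \<Rightarrow> 'b measure) \<Rightarrow> bool" where
  "mp_kernel M N k \<longleftrightarrow> markov_kernel M N k \<and>
     (\<forall>B\<in>sets N. (\<integral>x. measure (k x) B \<partial>M) = measure N B)"

definition kernel_ae_eq :: "'a measure \<Rightarrow> 'b measure \<Rightarrow> ('a \<Rightarrow> 'b measure) \<Rightarrow> ('a \<Rightarrow> 'b measure) \<Rightarrow> bool" where
  "kernel_ae_eq M N k h \<longleftrightarrow> (\<forall>B\<in>sets N. AE x in M. measure (k x) B = measure (h x) B)"

definition kcomp :: "('b \<Rightarrow> 'c measure) \<Rightarrow> ('a \<Rightarrow> 'b measure) \<Rightarrow> 'a \<Rightarrow> 'c measure" where
  "kcomp l k = (\<lambda>x. k x \<bind> l)"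

definition kid :: "'a measure \<Rightarrow> 'a \<Rightarrow> 'a measure" where
  "kid M = (\<lambda>x. return M x)"

definition bayes_inverse :: "'a measure \<Rightarrow> 'b measure \<Rightarrow> ('a \<Rightarrow> 'b measure) \<Rightarrow> ('b \<Rightarrow> 'a measure) \<Rightarrow> bool" where
  "bayes_inverse M N k kp \<longleftrightarrow> mp_kernel N M kp \<and>
     (\<forall>A\<in>sets M. \<forall>B\<in>sets N.
        (\<integral>x\<in>A. measure (k x) B \<partial>M) = (\<integral>y\<in>B. measure (kp y) A \<partial>N))"

definition standard_borel_prob :: "'b::polish_space measure \<Rightarrow> bool" where
  "standard_borel_prob N \<longleftrightarrow> prob_space N \<and> sets N = sets borel"

definition GKrn_iso :: "'a measure \<Rightarrow> 'b measure \<Rightarrow> bool" where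
  "GKrn_iso M N \<longleftrightarrow> (\<exists>k h. mp_kernel M N k \<and> mp_kernel N M h \<and>
      kernel_ae_eq M M (kcomp h k) (kid M) \<and> kernel_ae_eq N N (kcomp k h) (kid N))"

definition ess_standard_borel :: "'b::polish_space itself \<Rightarrow> 'a measure \<Rightarrow> bool" where
  "ess_standard_borel _ M \<longleftrightarrow> prob_space M \<and>
     (\<exists>N::'b measure. standard_borel_prob N \<and> GKrn_iso M N)"

definition dagger_idem :: "'a measure \<Rightarrow> ('a \<Rightarrow> 'a measure) \<Rightarrow> bool" where
  "dagger_idem M e \<longleftrightarrow> mp_kernel M M e \<and> kernel_ae_eq M M (kcomp e e) e \<and>
     bayes_inverse M M e e"

definition idem_le :: "'a measure \<Rightarrow> ('a \<Rightarrow> 'a measure) \<Rightarrow> ('a \<Rightarrow> 'a measure) \<Rightarrow> bool" where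
  "idem_le M e f \<longleftrightarrow> kernel_ae_eq M M (kcomp e f) e \<and> kernel_ae_eq M M (kcomp f e) e"

definition directed_preorder :: "('i \<Rightarrow> 'i \<Rightarrow> bool) \<Rightarrow> bool" where
  "directed_preorder le \<longleftrightarrow> (\<forall>i. le i i) \<and> (\<forall>i j k. le i j \<longrightarrow> le j k \<longrightarrow> le i k) \<and>
     (\<forall>i j. \<exists>k. le i k \<and> le j k)"

definition net_filter :: "('i \<Rightarrow> 'i \<Rightarrow> bool) \<Rightarrow> 'i filter" where
  "net_filter le = (INF i. principal {j. le i j})"

definition one_sided_conv :: "'a measure \<Rightarrow> 'b measure \<Rightarrow> ('i \<Rightarrow> 'i \<Rightarrow> bool) \<Rightarrow>
    ('i \<Rightarrow> 'a \<Rightarrow> 'b measure) \<Rightarrow> ('a \<Rightarrow> 'b measure) \<Rightarrow> bool" where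
  "one_sided_conv M N le ks k \<longleftrightarrow> (\<forall>B\<in>sets N.
     ((\<lambda>i. \<integral>x. \<bar>measure (k x) B - measure (ks i x) B\<bar> \<partial>M) \<longlongrightarrow> 0) (net_filter le))"

definition two_sided_conv :: "'a measure \<Rightarrow> 'b measure \<Rightarrow> ('i \<Rightarrow> 'i \<Rightarrow> bool) \<Rightarrow>
    ('i \<Rightarrow> 'a \<Rightarrow> 'b measure) \<Rightarrow> ('a \<Rightarrow> 'b measure) \<Rightarrow> bool" where
  "two_sided_conv M N le ks k \<longleftrightarrow> one_sided_conv M N le ks k \<and>
     (\<exists>kps kp. (\<forall>i. bayes_inverse M N (ks i) (kps i)) \<and> bayes_inverse M N k kp \<and>
        one_sided_conv N M le kps kp)"

end

theory Submission
  imports Defs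
begin

text \<open>A dagger idempotent \<open>e\<close> is the conditional expectation onto the \<open>\<sigma>\<close>-algebra of its almost
  surely invariant sets \<open>{A. e(A | x) = 1\<^sub>A(x) a.s.}\<close>, and the order on idempotents is inclusion of
  these \<open>\<sigma>\<close>-algebras. Conversely every sub-\<open>\<sigma>\<close>-algebra of an essentially standard Borel space has
  a regular conditional probability, which is a dagger idempotent. Hence the supremum of an increasing
  net comes from the \<open>\<sigma>\<close>-algebra generated by the union, and the infimum of a decreasing net from the
  intersection. Monotonicity of \<open>\<parallel>e\<^sub>\<lambda> 1\<^sub>B\<parallel>\<^sub>2\<close> makes \<open>e\<^sub>\<lambda> 1\<^sub>B\<close> a Cauchy net in \<open>L\<^sup>2\<close>, hence in
  \<open>L\<^sup>1\<close>, and the limit is identified by its integrals over sets of the limiting \<open>\<sigma>\<close>-algebra. Since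
  idempotents are self-adjoint, one-sided and two-sided convergence coincide.\<close>

text \<open>Null sets shape the proof. Kernels are identified when they agree a.s. for each
  \<open>B\<close> separately, and the index set of a net may be uncountable, so exceptional sets
  can be merged neither over all \<open>B\<close> nor over all indices. Convergence is therefore
  proved in L1 for one \<open>B\<close> at a time, never pointwise along the net; sequences serve
  only to construct the L1 limit. In the decreasing case every index brings its own null set, and
  the intersection works because invariance is asked only a.s.: each invariant \<sigma>-algebra is
  closed under a.s. equality.

  The two identities of a dagger idempotent have separate tasks: \<open>e \<circ> e = e\<close>
  makes \<open>e(B | x)\<close> measurable for the invariant sets, \<open>e = e^+\<close> gives it
  the right integrals over them.

  For the converse, a measure has to be built from conditional expectations, each known only up to a
  null set. On the real line a distribution function does this, which is why Polish spaces are coded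
  in a bounded interval.\<close>

section \<open>Coding a Polish space in the reals\<close>

text \<open>Base 4 with digits 0 and 1: the tail after a digit is at most \<open>1/3\<close>, so no carries occur and
  the parity of \<open>\<lfloor>4\<^sup>n r\<rfloor>\<close> reads off the \<open>n\<close>-th digit.\<close>

definition digit_code :: "(nat \<Rightarrow> bool) \<Rightarrow> real" where
  "digit_code a = (\<Sum>k. of_bool (a k) / 4 ^ k)"

lemma summable_digit_code: "summable (\<lambda>k. of_bool (a k) / 4 ^ k :: real)"
  by (rule summable_comparison_test'[OF summable_geometric[of "1 / 4 :: real"]])
     (auto simp: power_divide)

lemma digit_code_nonneg: "0 \<le> digit_code a"
  unfolding digit_code_def by (intro suminf_nonneg summable_digit_code) auto

lemma digit_code_le: "digit_code a \<le> 4 / 3"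
proof -
  have "digit_code a \<le> (\<Sum>k. (1/4) ^ k)"
    unfolding digit_code_def
    by (rule suminf_le[OF _ summable_digit_code summable_geometric]) (auto simp: power_divide)
  also have "\<dots> = 4 / 3"
    by (subst suminf_geometric) auto
  finally show ?thesis .
qed

lemma digit_code_unfold: "digit_code a = of_bool (a 0) + digit_code (\<lambda>k. a (Suc k)) / 4"
proof -
  have "digit_code a = of_bool (a 0) / 4 ^ 0 + (\<Sum>k. of_bool (a (Suc k)) / 4 ^ Suc k)"
    unfolding digit_code_def using suminf_split_head[OF summable_digit_code[of a]] by simp
  also have "(\<Sum>k. of_bool (a (Suc k)) / 4 ^ Suc k) = (\<Sum>k. (of_bool (a (Suc k)) / 4 ^ k) / 4 :: real)"
    by (simp add: field_simps)
  also have "\<dots> = digit_code (\<lambda>k. a (Suc k)) / 4"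
    unfolding digit_code_def by (rule suminf_divide[OF summable_digit_code])
  finally show ?thesis by simp
qed

lemma odd_floor_digit_code: "odd \<lfloor>4 ^ n * digit_code a\<rfloor> \<longleftrightarrow> a n"
proof (induction n arbitrary: a)
  case 0
  have "\<lfloor>digit_code a\<rfloor> = of_bool (a 0)"
    using digit_code_nonneg[of "\<lambda>k. a (Suc k)"] digit_code_le[of "\<lambda>k. a (Suc k)"]
    by (intro floor_unique) (auto simp: digit_code_unfold[of a])
  then show ?case by simp
next
  case (Suc n)
  \<comment> \<open>The leading digit becomes an even integer, so it shifts the floor without
    changing its parity; the rest is the induction hypothesis for the shifted sequence.\<close>
  have "4 ^ Suc n * digit_code a = of_int (4 ^ Suc n * of_bool (a 0)) + 4 ^ n * digit_code (\<lambda>k. a (Suc k))"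
    by (subst digit_code_unfold) (simp add: field_simps)
  then have "\<lfloor>4 ^ Suc n * digit_code a\<rfloor> = 4 ^ Suc n * of_bool (a 0) + \<lfloor>4 ^ n * digit_code (\<lambda>k. a (Suc k))\<rfloor>"
    by (metis floor_add_int add.commute)
  with Suc show ?case by simp
qed

text \<open>A point is encoded by the relation \<open>dist (d j) y < 2\<^sup>-\<^sup>n\<close> to a dense sequence \<open>d\<close> and recovered
  as the limit of the first \<open>d j\<close> in each ball; completeness makes the recovery map measurable on
  all of \<open>\<real>\<close>.\<close>

lemma polish_real_coding:
  obtains \<phi> :: "'b::polish_space \<Rightarrow> real" and \<psi> :: "real \<Rightarrow> 'b"
  where "\<phi> \<in> borel_measurable borel" "\<psi> \<in> borel_measurable borel"
    "\<And>y. \<psi> (\<phi> y) = y" "\<And>y. 0 \<le> \<phi> y" "\<And>y. \<phi> y \<le> 4 / 3"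
proof -
  obtain D :: "'b set" where D: "countable D" "\<And>X. open X \<Longrightarrow> X \<noteq> {} \<Longrightarrow> \<exists>d\<in>D. d \<in> X"
    using countable_dense_setE by blast
  then have "D \<noteq> {}" using open_UNIV by blast
  define d where "d = from_nat_into D"
  have dense: "\<exists>j. dist (d j) y < \<epsilon>" if "\<epsilon> > 0" for y \<epsilon>
  proof -
    obtain z where "z \<in> D" "dist y z < \<epsilon>"
      using D(2)[of "ball y \<epsilon>"] \<open>\<epsilon> > 0\<close> by auto
    then show ?thesis
      unfolding d_def by (metis D(1) dist_commute from_nat_into_to_nat_on)
  qed
  define a where "a y k = (dist (d (snd (prod_decode k))) y < 1 / 2 ^ fst (prod_decode k))" for y k
  define \<phi> where "\<phi> y = digit_code (a y)" for y
  \<comment> \<open>On a code of \<open>y\<close> the parity test means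
    \<open>dist (d j) y < 1 / 2 ^ n\<close>, so this is the first centre within that distance; on
    any other real it is just some point of the sequence.\<close>
  define s where "s n r = d (LEAST j. odd \<lfloor>4 ^ prod_encode (n, j) * r\<rfloor>)" for n and r :: real
  define \<psi> where "\<psi> r = (if Cauchy (\<lambda>n. s n r) then lim (\<lambda>n. s n r) else d 0)" for r
  have s_meas [measurable]: "s n \<in> borel_measurable borel" for n
    unfolding s_def by measurable
  show thesis
  proof
    show "\<phi> \<in> borel_measurable borel"
      unfolding \<phi>_def digit_code_def a_def by measurable
    \<comment> \<open>Switching to the constant sequence \<open>d 0\<close> off the Cauchy set gives
      convergence at every real, as the limit theorem for measurable maps requires.\<close>
    have "(\<lambda>r. if Cauchy (\<lambda>n. s n r) then s n r else d 0) \<in> borel_measurable borel" for n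
      by measurable
    moreover have "(\<lambda>n. if Cauchy (\<lambda>n. s n r) then s n r else d 0) \<longlonglongrightarrow> \<psi> r" for r
      unfolding \<psi>_def using Cauchy_convergent[of "\<lambda>n. s n r"]
      by (cases "Cauchy (\<lambda>n. s n r)") (simp_all add: convergent_LIMSEQ_iff)
    ultimately show "\<psi> \<in> borel_measurable borel"
      by (rule borel_measurable_LIMSEQ_metric)
    fix y
    show "0 \<le> \<phi> y" "\<phi> y \<le> 4 / 3"
      unfolding \<phi>_def by (rule digit_code_nonneg digit_code_le)+
    have close: "dist (s n (\<phi> y)) y < 1 / 2 ^ n" for n
    proof -
      have "odd \<lfloor>4 ^ prod_encode (n, j) * \<phi> y\<rfloor> \<longleftrightarrow> dist (d j) y < 1 / 2 ^ n" for j
        by (simp add: \<phi>_def odd_floor_digit_code a_def)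
      then show ?thesis
        unfolding s_def using LeastI_ex[OF dense[of "1 / 2 ^ n" y]] by simp
    qed
    have "(\<lambda>n. 1 / 2 ^ n :: real) \<longlonglongrightarrow> 0"
      using LIMSEQ_power_zero[of "1 / 2 :: real"] by (simp add: power_divide)
    then have "(\<lambda>n. dist (s n (\<phi> y)) y) \<longlonglongrightarrow> 0"
      by (rule tendsto_sandwich[OF _ _ tendsto_const, rotated 2])
         (simp_all add: close less_imp_le)
    then have "(\<lambda>n. s n (\<phi> y)) \<longlonglongrightarrow> y"
      by (rule tendsto_dist_iff[THEN iffD2])
    then show "\<psi> (\<phi> y) = y"
      unfolding \<psi>_def using LIMSEQ_imp_Cauchy limI by metis
  qed
qed

section \<open>Conditional expectations of kernels\<close>

lemma kernel_space:
  assumes "k \<in> M \<rightarrow>\<^sub>M prob_algebra N" "x \<in> space M"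
  shows "prob_space (k x)" "sets (k x) = sets N" "space (k x) = space N"
  using measurable_space[OF assms] by (auto simp: space_prob_algebra dest: sets_eq_imp_space_eq)

lemma kernel_integrable:
  fixes f :: "'b \<Rightarrow> real"
  assumes "k \<in> M \<rightarrow>\<^sub>M prob_algebra N" "x \<in> space M"
    and "f \<in> borel_measurable N" "\<And>y. y \<in> space N \<Longrightarrow> \<bar>f y\<bar> \<le> B"
  shows "integrable (k x) f"
proof -
  interpret prob_space "k x" using kernel_space[OF assms(1,2)] by simp
  show ?thesis
    using kernel_space[OF assms(1,2)] assms(3,4)
    by (intro integrable_const_bound[of _ B]) (auto cong: measurable_cong_sets)
qed

lemma kernel_integral_measurable [measurable (raw)]:
  fixes f :: "'b \<Rightarrow> real"
  assumes "k \<in> M \<rightarrow>\<^sub>M prob_algebra N" "f \<in> borel_measurable N"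
  shows "(\<lambda>x. \<integral>y. f y \<partial>k x) \<in> borel_measurable M"
  using integral_measurable_subprob_algebra[OF assms(2)] measurable_prob_algebraD[OF assms(1)]
  by measurable

lemma kernel_measure_measurable:
  assumes "k \<in> M \<rightarrow>\<^sub>M prob_algebra N" "B \<in> sets N"
  shows "(\<lambda>x. measure (k x) B) \<in> borel_measurable M"
  using measurable_prob_algebraD[OF assms(1)] assms(2) by measurable

lemma kernel_integral_bounds:
  fixes f :: "'b \<Rightarrow> real"
  assumes k: "k \<in> M \<rightarrow>\<^sub>M prob_algebra N" and x: "x \<in> space M"
    and f: "f \<in> borel_measurable N" "\<And>y. y \<in> space N \<Longrightarrow> 0 \<le> f y \<and> f y \<le> 1"
  shows "0 \<le> (\<integral>y. f y \<partial>k x)" "(\<integral>y. f y \<partial>k x) \<le> 1"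
proof -
  interpret prob_space "k x" using kernel_space[OF k x] by simp
  show "0 \<le> (\<integral>y. f y \<partial>k x)"
    using f kernel_space[OF k x] by (intro integral_nonneg_AE AE_I2) auto
  have "integrable (k x) f"
    by (rule kernel_integrable[OF k x f(1), of 1]) (use f(2) in fastforce)
  then have "(\<integral>y. f y \<partial>k x) \<le> (\<integral>y. 1 \<partial>k x)"
    using f kernel_space[OF k x] by (intro integral_mono) auto
  then show "(\<integral>y. f y \<partial>k x) \<le> 1" by (simp add: prob_space)
qed

lemma measure_kcomp:
  assumes k: "k \<in> M \<rightarrow>\<^sub>M prob_algebra N" and h: "h \<in> N \<rightarrow>\<^sub>M prob_algebra L"
    and x: "x \<in> space M" and B: "B \<in> sets L"
  shows "measure (kcomp h k x) B = (\<integral>y. measure (h y) B \<partial>k x)"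
proof -
  interpret prob_space "k x" using kernel_space[OF k x] by simp
  have "(\<lambda>y. measure (h y) B) \<in> borel_measurable (k x)"
    using kernel_measure_measurable[OF h B] kernel_space[OF k x] by (simp cong: measurable_cong_sets)
  moreover have "h \<in> k x \<rightarrow>\<^sub>M subprob_algebra L"
    using measurable_prob_algebraD[OF h] kernel_space[OF k x] by (simp cong: measurable_cong_sets)
  ultimately show ?thesis
    unfolding kcomp_def by (intro subprob_space.measure_bind[OF _ _ B]) unfold_locales
qed

text \<open>Restricting \<open>M\<close> to \<open>A\<close> and then applying \<open>k\<close>
  gives one finite measure on \<open>N\<close>, the mixture of the \<open>k x\<close> over
  \<open>A\<close>. Set integrals of kernels become integrals against it, so uniqueness theorems for
  measures apply to them.\<close>

lemma nn_integral_density_bind_kernel: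
  fixes f :: "'b \<Rightarrow> real"
  assumes M: "prob_space M" and k: "k \<in> M \<rightarrow>\<^sub>M prob_algebra N" and A: "A \<in> sets M"
    and f: "f \<in> borel_measurable N" "\<And>y. y \<in> space N \<Longrightarrow> 0 \<le> f y \<and> f y \<le> 1"
  shows "(\<integral>\<^sup>+y. ennreal (f y) \<partial>(density M (indicator A) \<bind> k)) = ennreal (\<integral>x\<in>A. (\<integral>y. f y \<partial>k x) \<partial>M)"
proof -
  interpret prob_space M by fact
  have k': "k \<in> M \<rightarrow>\<^sub>M subprob_algebra N" by (rule measurable_prob_algebraD[OF k])
  have meas: "(\<lambda>x. \<integral>y. f y \<partial>k x) \<in> borel_measurable M"
    by (rule kernel_integral_measurable[OF k f(1)])
  have "(\<integral>\<^sup>+y. ennreal (f y) \<partial>(density M (indicator A) \<bind> k))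
      = (\<integral>\<^sup>+x. \<integral>\<^sup>+y. ennreal (f y) \<partial>k x \<partial>density M (indicator A))"
    using f(1) k' by (intro nn_integral_bind[of _ N]) auto
  also have "\<dots> = (\<integral>\<^sup>+x. indicator A x * (\<integral>\<^sup>+y. ennreal (f y) \<partial>k x) \<partial>M)"
  proof (rule nn_integral_density)
    note [measurable] = A f(1) k'
    show "(indicator A :: 'a \<Rightarrow> ennreal) \<in> borel_measurable M"
      "(\<lambda>x. \<integral>\<^sup>+y. ennreal (f y) \<partial>k x) \<in> borel_measurable M"
      by measurable
  qed
  also have "\<dots> = (\<integral>\<^sup>+x. ennreal (indicator A x * (\<integral>y. f y \<partial>k x)) \<partial>M)"
  proof (rule nn_integral_cong)
    fix x assume x: "x \<in> space M"
    have "integrable (k x) f"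
      by (rule kernel_integrable[OF k x f(1), of 1]) (use f(2) in fastforce)
    then have "(\<integral>\<^sup>+y. ennreal (f y) \<partial>k x) = ennreal (\<integral>y. f y \<partial>k x)"
      using f kernel_space[OF k x] by (intro nn_integral_eq_integral AE_I2) auto
    then show "indicator A x * (\<integral>\<^sup>+y. ennreal (f y) \<partial>k x) = ennreal (indicator A x * (\<integral>y. f y \<partial>k x))"
      by (simp split: split_indicator)
  qed
  also have "\<dots> = ennreal (\<integral>x. indicator A x * (\<integral>y. f y \<partial>k x) \<partial>M)"
    using A meas kernel_integral_bounds[OF k _ f]
    by (intro nn_integral_eq_integral AE_I2 integrable_const_bound[of _ 1])
       (auto split: split_indicator)
  finally show ?thesis by (simp add: set_lebesgue_integral_def)
qed

lemma emeasure_density_bind_kernel: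
  assumes "prob_space M" "k \<in> M \<rightarrow>\<^sub>M prob_algebra N" "A \<in> sets M" "C \<in> sets N"
  shows "emeasure (density M (indicator A) \<bind> k) C = ennreal (\<integral>x\<in>A. measure (k x) C \<partial>M)"
proof -
  interpret prob_space M by fact
  have sets: "sets (density M (indicator A) \<bind> k) = sets N"
    using assms(2) not_empty by (intro sets_bind) (auto dest: kernel_space)
  have "emeasure (density M (indicator A) \<bind> k) C
      = (\<integral>\<^sup>+y. ennreal (indicator C y) \<partial>(density M (indicator A) \<bind> k))"
    using sets assms(4) by (simp add: ennreal_indicator)
  also have "\<dots> = ennreal (\<integral>x\<in>A. (\<integral>y. indicator C y \<partial>k x) \<partial>M)"
    using assms by (intro nn_integral_density_bind_kernel) (auto split: split_indicator)
  also have "(\<integral>x\<in>A. (\<integral>y. indicator C y \<partial>k x) \<partial>M) = (\<integral>x\<in>A. measure (k x) C \<partial>M)"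
  proof (rule set_lebesgue_integral_cong[OF assms(3)], intro allI impI)
    fix x assume "x \<in> A"
    then have "x \<in> space M" using assms(3) sets.sets_into_space by blast
    then have "C \<inter> space (k x) = C"
      using kernel_space[OF assms(2)] assms(4) sets.sets_into_space by blast
    then show "(\<integral>y. indicator C y \<partial>k x) = measure (k x) C" by simp
  qed
  finally show ?thesis .
qed

text \<open>Agreement on all \<open>C\<close> says that the mixtures of \<open>g\<close> and
  \<open>k\<close> over \<open>A\<close> are the same measure, against which \<open>f\<close> is
  then integrated; this replaces an approximation by simple functions.\<close>

lemma set_integral_kernel_eq:
  fixes f :: "'b \<Rightarrow> real"
  assumes M: "prob_space M" and A: "A \<in> sets M"
    and k: "k \<in> M \<rightarrow>\<^sub>M prob_algebra N" and g: "g \<in> M \<rightarrow>\<^sub>M prob_algebra N"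
    and eq: "\<And>C. C \<in> sets N \<Longrightarrow> (\<integral>x\<in>A. measure (g x) C \<partial>M) = (\<integral>x\<in>A. measure (k x) C \<partial>M)"
    and f: "f \<in> borel_measurable N" "\<And>y. y \<in> space N \<Longrightarrow> 0 \<le> f y \<and> f y \<le> 1"
  shows "(\<integral>x\<in>A. (\<integral>y. f y \<partial>g x) \<partial>M) = (\<integral>x\<in>A. (\<integral>y. f y \<partial>k x) \<partial>M)"
proof -
  interpret prob_space M by fact
  have sets: "sets (density M (indicator A) \<bind> l) = sets N" if "l \<in> M \<rightarrow>\<^sub>M prob_algebra N" for l
    using that not_empty by (intro sets_bind) (auto dest: kernel_space)
  have "density M (indicator A) \<bind> g = density M (indicator A) \<bind> k"
    using eq sets[OF k] sets[OF g] emeasure_density_bind_kernel[OF M(1) k A]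
      emeasure_density_bind_kernel[OF M(1) g A]
    by (intro measure_eqI) auto
  then have "ennreal (\<integral>x\<in>A. (\<integral>y. f y \<partial>g x) \<partial>M) = ennreal (\<integral>x\<in>A. (\<integral>y. f y \<partial>k x) \<partial>M)"
    using nn_integral_density_bind_kernel[OF M(1) k A f] nn_integral_density_bind_kernel[OF M(1) g A f]
    by simp
  moreover have "0 \<le> (\<integral>x\<in>A. (\<integral>y. f y \<partial>l x) \<partial>M)" if "l \<in> M \<rightarrow>\<^sub>M prob_algebra N" for l
    unfolding set_lebesgue_integral_def
    using kernel_integral_bounds[OF that _ f]
    by (intro integral_nonneg_AE AE_I2) (auto split: split_indicator)
  ultimately show ?thesis using k g by simp
qed

text \<open>\<open>g\<close> is a regular version of the conditional expectation of the kernel \<open>k\<close> given \<open>F\<close>. For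
  \<open>k = kid M\<close> this is a regular conditional probability: \<open>g(B | x) = \<E>[1\<^sub>B | F](x)\<close>.\<close>

definition cond_kernel :: "'a measure \<Rightarrow> 'a measure \<Rightarrow> 'b measure \<Rightarrow> ('a \<Rightarrow> 'b measure) \<Rightarrow> ('a \<Rightarrow> 'b measure) \<Rightarrow> bool" where
  "cond_kernel M F N k g \<longleftrightarrow> g \<in> F \<rightarrow>\<^sub>M prob_algebra N \<and>
     (\<forall>A\<in>sets F. \<forall>C\<in>sets N. (\<integral>x\<in>A. measure (g x) C \<partial>M) = (\<integral>x\<in>A. measure (k x) C \<partial>M))"

lemma cond_kernel_integral:
  fixes f :: "'b \<Rightarrow> real"
  assumes M: "prob_space M" "subalgebra M F" and k: "k \<in> M \<rightarrow>\<^sub>M prob_algebra N"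
    and g: "cond_kernel M F N k g" and A: "A \<in> sets F"
    and f: "f \<in> borel_measurable N" "\<And>y. y \<in> space N \<Longrightarrow> 0 \<le> f y \<and> f y \<le> 1"
  shows "(\<integral>x\<in>A. (\<integral>y. f y \<partial>g x) \<partial>M) = (\<integral>x\<in>A. (\<integral>y. f y \<partial>k x) \<partial>M)"
proof (rule set_integral_kernel_eq[OF M(1) _ k _ _ f])
  show "A \<in> sets M" using A M(2) by (auto simp: subalgebra_def)
  show "g \<in> M \<rightarrow>\<^sub>M prob_algebra N"
    using g measurable_from_subalg[OF M(2)] by (auto simp: cond_kernel_def)
qed (use g A in \<open>auto simp: cond_kernel_def\<close>)

text \<open>Half-lines form a generating class stable under intersection, and both mixtures over
  \<open>A\<close> are finite on them, so uniqueness of measures applies for each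
  \<open>A\<close>.\<close>

lemma cond_kernel_realI:
  fixes g k :: "'a \<Rightarrow> real measure"
  assumes M: "prob_space M" "subalgebra M F" and k: "k \<in> M \<rightarrow>\<^sub>M prob_algebra borel"
    and g: "g \<in> F \<rightarrow>\<^sub>M prob_algebra borel"
    and eq: "\<And>A r. A \<in> sets F \<Longrightarrow> (\<integral>x\<in>A. measure (g x) {..r} \<partial>M) = (\<integral>x\<in>A. measure (k x) {..r} \<partial>M)"
  shows "cond_kernel M F borel k g"
  unfolding cond_kernel_def
proof (intro conjI ballI)
  interpret prob_space M by fact
  fix A and C :: "real set" assume A: "A \<in> sets F" and C: "C \<in> sets borel"
  have A': "A \<in> sets M" using A M(2) by (auto simp: subalgebra_def)
  have g': "g \<in> M \<rightarrow>\<^sub>M prob_algebra borel"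
    using g measurable_from_subalg[OF M(2)] by auto
  have sets: "sets (density M (indicator A) \<bind> l) = sets borel" if "l \<in> M \<rightarrow>\<^sub>M prob_algebra borel" for l :: "'a \<Rightarrow> real measure"
    using that not_empty by (intro sets_bind) (auto dest: kernel_space)
  have "density M (indicator A) \<bind> g = density M (indicator A) \<bind> k"
  proof (rule measure_eqI_generator_eq[of "range atMost" UNIV _ _ "\<lambda>n::nat. {..real n}"])
    show "Int_stable (range atMost :: real set set)"
      by (auto simp: Int_stable_def)
    show "sets (density M (indicator A) \<bind> g) = sigma_sets UNIV (range atMost)"
      "sets (density M (indicator A) \<bind> k) = sigma_sets UNIV (range atMost)"
      unfolding sets[OF k] sets[OF g'] borel_eq_atMost by auto
    show "(\<Union>n. {..real n}) = UNIV"
      using real_arch_simple by auto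
  qed (auto simp: emeasure_density_bind_kernel[OF M(1) k A'] emeasure_density_bind_kernel[OF M(1) g' A'] eq A)
  then have "ennreal (\<integral>x\<in>A. measure (g x) C \<partial>M) = ennreal (\<integral>x\<in>A. measure (k x) C \<partial>M)"
    by (metis emeasure_density_bind_kernel[OF M(1) k A' C] emeasure_density_bind_kernel[OF M(1) g' A' C])
  moreover have "0 \<le> (\<integral>x\<in>A. measure (l x) C \<partial>M)" for l :: "'a \<Rightarrow> real measure"
    unfolding set_lebesgue_integral_def by (intro integral_nonneg_AE AE_I2) auto
  ultimately show "(\<integral>x\<in>A. measure (g x) C \<partial>M) = (\<integral>x\<in>A. measure (k x) C \<partial>M)"
    by simp
qed (rule g)

section \<open>Existence of regular conditional kernels\<close>

lemma finite_measure_subalgebraI: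
  "prob_space M \<Longrightarrow> subalgebra M F \<Longrightarrow> finite_measure_subalgebra M F"
  by (simp add: finite_measure_subalgebra_def finite_measure_subalgebra_axioms_def prob_space_def)

text \<open>The conditional distribution functions at rational points are truncated so that \<open>G x\<close> below is a
  distribution function for every \<open>x\<close>, with no exceptional null set. That \<open>G x r\<close> is still a version
  of the conditional expectation follows from \<open>E r \<le> G r\<close> a.e. and equality of the integrals.\<close>

lemma ex_cond_kernel_real:
  fixes k :: "'a \<Rightarrow> real measure"
  assumes M: "prob_space M" "subalgebra M F" and k: "k \<in> M \<rightarrow>\<^sub>M prob_algebra borel"
    and supp: "\<And>x. x \<in> space M \<Longrightarrow> measure (k x) {0..<2} = 1"
  shows "\<exists>g. cond_kernel M F borel k g"
proof -
  interpret prob_space M by fact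
  interpret finite_measure_subalgebra M F by (rule finite_measure_subalgebraI[OF M])
  define c where "c r x = measure (k x) {..r}" for r x
  define E where "E r = real_cond_exp M F (c r)" for r
  \<comment> \<open>The values forced below 0 and from 2 on agree with \<open>E\<close> a.e. because
    of \<open>supp\<close>, and they settle the limits at both infinities for every
    \<open>x\<close>.\<close>
  define H where "H q x = (if q < 0 then 0 else if 2 \<le> q then 1 else max 0 (min 1 (E q x)))" for q x
  \<comment> \<open>An infimum over \<open>q > r\<close> is monotone and right continuous in
    \<open>r\<close> whether or not \<open>H q x\<close> is monotone in \<open>q\<close>;
    restricting to rationals keeps it measurable.\<close>
  define G where "G x r = (INF q\<in>{q\<in>\<rat>. r < q}. H q x)" for x r
  have c_meas [measurable]: "c r \<in> borel_measurable M" for r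
    unfolding c_def by (rule kernel_measure_measurable[OF k]) simp
  have c_bounds: "0 \<le> c r x" "c r x \<le> 1" if "x \<in> space M" for r x
    using prob_space.prob_le_1[OF kernel_space(1)[OF k that]] by (auto simp: c_def)
  have c_int: "integrable M (c r)" for r
    using c_bounds by (intro integrable_const_bound[of _ 1]) auto
  have c_mono: "c r x \<le> c s x" if "x \<in> space M" "r \<le> s" for r s x
  proof -
    interpret k: prob_space "k x" by (rule kernel_space(1)[OF k that(1)])
    show ?thesis unfolding c_def
      using that kernel_space(2)[OF k that(1)] by (intro k.finite_measure_mono) auto
  qed
  have c_neg: "c r x = 0" if "x \<in> space M" "r < 0" for r x
  proof -
    interpret k: prob_space "k x" by (rule kernel_space(1)[OF k that(1)])
    have "measure (k x) ({..r} \<union> {0..<2}) = c r x + measure (k x) {0..<2}"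
      unfolding c_def using that kernel_space(2)[OF k that(1)] by (intro k.finite_measure_Union) auto
    moreover have "measure (k x) ({..r} \<union> {0..<2}) \<le> 1" by (rule k.prob_le_1)
    ultimately show ?thesis using supp[OF that(1)] c_bounds[OF that(1), of r] by simp
  qed
  have c_top: "c r x = 1" if "x \<in> space M" "2 \<le> r" for r x
  proof -
    interpret k: prob_space "k x" by (rule kernel_space(1)[OF k that(1)])
    have "measure (k x) {0..<2} \<le> c r x"
      unfolding c_def using that kernel_space(2)[OF k that(1)] by (intro k.finite_measure_mono) auto
    then show ?thesis using supp[OF that(1)] c_bounds[OF that(1), of r] by simp
  qed
  have E_meas [measurable]: "E r \<in> borel_measurable F" for r
    unfolding E_def by simp
  have E_meas' [measurable]: "E r \<in> borel_measurable M" for r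
    by (rule measurable_from_subalg[OF M(2) E_meas])
  have E_int: "integrable M (E r)" "(\<integral>x. E r x \<partial>M) = (\<integral>x. c r x \<partial>M)" for r
    unfolding E_def using real_cond_exp_int[OF c_int] by auto
  have H_meas [measurable]: "H q \<in> borel_measurable F" for q
    unfolding H_def by measurable
  have H_bounds: "0 \<le> H q x" "H q x \<le> 1" for q x
    by (auto simp: H_def)
  have H_eq: "AE x in M. H q x = E q x" for q
  proof -
    have "AE x in M. E q x \<ge> 0"
      unfolding E_def using c_bounds by (intro real_cond_exp_ge_c c_int AE_I2) auto
    moreover have "AE x in M. E q x \<le> 1"
      unfolding E_def using c_bounds by (intro real_cond_exp_le_c c_int AE_I2) auto
    moreover have "AE x in M. q < 0 \<longrightarrow> E q x = 0"
    proof (cases "q < 0")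
      case True
      have "AE x in M. E q x = real_cond_exp M F (\<lambda>_. 0) x"
        unfolding E_def using c_neg True by (intro real_cond_exp_cong AE_I2) auto
      moreover have "AE x in M. real_cond_exp M F (\<lambda>_. 0) x = 0"
        by (rule real_cond_exp_F_meas) auto
      ultimately show ?thesis by eventually_elim auto
    qed auto
    moreover have "AE x in M. 2 \<le> q \<longrightarrow> E q x = 1"
    proof (cases "2 \<le> q")
      case True
      have "AE x in M. E q x = real_cond_exp M F (\<lambda>_. 1) x"
        unfolding E_def using c_top True by (intro real_cond_exp_cong AE_I2) auto
      moreover have "AE x in M. real_cond_exp M F (\<lambda>_. 1) x = 1"
        by (rule real_cond_exp_F_meas) auto
      ultimately show ?thesis by eventually_elim auto
    qed auto
    ultimately show ?thesis
      by eventually_elim (auto simp: H_def)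
  qed
  have bdd: "bdd_below ((\<lambda>q. H q x) ` {q\<in>\<rat>. r < q})" for x r
    using H_bounds by (intro bdd_belowI2[of _ 0]) auto
  have rat_above: "\<exists>q\<in>\<rat>. r < q \<and> q < s" if "r < s" for r s :: real
    using Rats_dense_in_real[OF that] by auto
  have ne: "{q\<in>\<rat>. r < q} \<noteq> {}" for r :: real
    using rat_above[of r "r + 1"] by auto
  have G_meas [measurable]: "(\<lambda>x. G x r) \<in> borel_measurable F" for r
    unfolding G_def by (intro borel_measurable_cINF_real) (auto intro: countable_subset[OF _ countable_rat])
  have G_meas' [measurable]: "(\<lambda>x. G x r) \<in> borel_measurable M" for r
    by (rule measurable_from_subalg[OF M(2) G_meas])
  have G_le: "G x r \<le> H q x" if "q \<in> \<rat>" "r < q" for x r q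
    unfolding G_def using that by (intro cINF_lower bdd) auto
  have G_ge: "a \<le> G x r" if "\<And>q. q \<in> \<rat> \<Longrightarrow> r < q \<Longrightarrow> a \<le> H q x" for x r a
    unfolding G_def using that ne by (intro cINF_greatest) auto
  have G_mono: "G x r \<le> G x s" if "r \<le> s" for x r s
    using that by (intro G_ge G_le) auto
  have G_bounds: "0 \<le> G x r" "G x r \<le> 1" for x r
  proof -
    show "0 \<le> G x r" using H_bounds by (intro G_ge)
    obtain q where "q \<in> \<rat>" "r < q" using ne[of r] by auto
    then show "G x r \<le> 1" using G_le[of q r x] H_bounds(2)[of q x] by simp
  qed
  have G_cont: "continuous (at_right a) (G x)" for x a
    unfolding continuous_within
  proof (rule order_tendstoI)
    fix b assume "b < G x a"
    then show "\<forall>\<^sub>F r in at_right a. b < G x r"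
      using G_mono[of a _ x] by (intro eventually_at_rightI[of a "a + 1"]) (auto intro: less_le_trans)
  next
    fix b assume "G x a < b"
    then obtain q where q: "q \<in> \<rat>" "a < q" "H q x < b"
      unfolding G_def using cINF_less_iff[OF ne bdd] by auto
    show "\<forall>\<^sub>F r in at_right a. G x r < b"
      using q G_le[OF q(1)] by (intro eventually_at_rightI[of a q]) (auto intro: le_less_trans)
  qed
  have G_neg: "G x r = 0" if "r < 0" for x r
  proof -
    obtain q where "q \<in> \<rat>" "r < q" "q < 0" using rat_above[OF \<open>r < 0\<close>] by auto
    then show ?thesis using G_le[of q r x] G_bounds(1)[of x r] by (simp add: H_def)
  qed
  have G_top: "G x r = 1" if "2 \<le> r" for x r
  proof -
    have "1 \<le> G x r" using that by (intro G_ge) (auto simp: H_def)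
    then show ?thesis using G_bounds(2)[of x r] by simp
  qed
  have G_bot: "(G x \<longlongrightarrow> 0) at_bot" for x
    by (rule tendsto_eventually) (auto intro!: eventually_at_bot_linorderI[of "-1"] G_neg)
  have G_lim_top: "(G x \<longlongrightarrow> 1) at_top" for x
    by (rule tendsto_eventually) (auto intro!: eventually_at_top_linorderI[of 2] G_top)

  define g where "g x = interval_measure (G x)" for x
  have g_Iic: "measure (g x) {..r} = G x r" "emeasure (g x) {..r} = ennreal (G x r)" for x r
    unfolding g_def
    by (rule measure_interval_measure_Iic emeasure_interval_measure_Iic; fact G_mono G_cont G_bot)+
  have g_prob: "prob_space (g x)" for x
    using real_distribution_interval_measure[OF G_mono G_cont G_bot G_lim_top, of x]
    by (simp add: g_def real_distribution_def)
  have g: "g \<in> F \<rightarrow>\<^sub>M prob_algebra borel"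
  proof (rule measurable_prob_algebra_generated[of _ UNIV "range atMost"])
    show "sets borel = sigma_sets UNIV (range atMost :: real set set)"
      unfolding borel_eq_atMost by auto
    show "Int_stable (range atMost :: real set set)"
      by (auto simp: Int_stable_def)
    show "(\<lambda>a. emeasure (g a) A) \<in> borel_measurable F" if "A \<in> range atMost" for A
      using that g_Iic by auto
  qed (use g_prob in \<open>auto simp: g_def\<close>)

  have G_eq: "AE x in M. G x r = E r x" for r
  proof -
    \<comment> \<open>Only countably many \<open>q\<close> occur, so the null sets of
      \<open>E r \<le> E q = H q\<close> combine before the infimum is taken.\<close>
    have E_le_H: "AE x in M. \<forall>q\<in>{q\<in>\<rat>. r < q}. E r x \<le> H q x"
    proof (rule AE_ball_countable'[OF _ countable_subset[OF _ countable_rat]])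
      fix q assume q: "q \<in> {q \<in> \<rat>. r < q}"
      have "AE x in M. E r x \<le> E q x"
        unfolding E_def using q c_mono by (intro real_cond_exp_mono c_int AE_I2) auto
      with H_eq[of q] show "AE x in M. E r x \<le> H q x" by eventually_elim auto
    qed auto
    then have E_le: "AE x in M. E r x \<le> G x r"
      by eventually_elim (auto intro!: G_ge)
    have G_int: "integrable M (\<lambda>x. G x r)"
      using G_bounds by (intro integrable_const_bound[of _ 1]) auto
    have "\<forall>n. \<exists>q. q \<in> \<rat> \<and> r < q \<and> q < r + 1 / real (Suc n)"
      using rat_above[of r "r + 1 / real (Suc n)" for n] by fastforce
    then obtain q where q: "\<And>n. q n \<in> \<rat>" "\<And>n. r < q n" "\<And>n. q n < r + 1 / real (Suc n)"
      by metis
    have "q \<longlonglongrightarrow> r"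
    proof (rule tendsto_sandwich[OF _ _ tendsto_const])
      show "\<forall>\<^sub>F n in sequentially. r \<le> q n" "\<forall>\<^sub>F n in sequentially. q n \<le> r + 1 / real (Suc n)"
        using q by (auto intro!: always_eventually less_imp_le simp del: of_nat_Suc)
      show "(\<lambda>n. r + 1 / real (Suc n)) \<longlonglongrightarrow> r"
        using tendsto_add[OF tendsto_const LIMSEQ_inverse_real_of_nat, of r] by (simp add: inverse_eq_divide)
    qed
    then have q_lim: "filterlim q (at_right r) sequentially"
      by (rule tendsto_imp_filterlim_at_right) (simp add: q(2))
    \<comment> \<open>The integral of \<open>G\<close> at \<open>r\<close> is at most that of
      \<open>c (q n)\<close>; right continuity of the distribution functions of the
      \<open>k x\<close> lets this bound descend to \<open>c r\<close>.\<close>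
    have "(\<lambda>n. \<integral>x. c (q n) x \<partial>M) \<longlonglongrightarrow> (\<integral>x. c r x \<partial>M)"
    proof (rule integral_dominated_convergence[where w="\<lambda>_. 1"])
      show "AE x in M. (\<lambda>n. c (q n) x) \<longlonglongrightarrow> c r x"
      proof (rule AE_I2)
        fix x assume x: "x \<in> space M"
        interpret k: prob_space "k x" by (rule kernel_space(1)[OF k x])
        interpret k: finite_borel_measure "k x"
          by standard (simp add: kernel_space(2)[OF k x])
        have "((\<lambda>s. c s x) \<longlongrightarrow> c r x) (at_right r)"
          using k.cdf_is_right_cont[of r] by (simp add: c_def cdf_def continuous_within)
        then show "(\<lambda>n. c (q n) x) \<longlonglongrightarrow> c r x"
          by (rule filterlim_compose[OF _ q_lim])
      qed
    qed (use c_bounds in auto)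
    moreover have "(\<integral>x. G x r \<partial>M) \<le> (\<integral>x. c (q n) x \<partial>M)" for n
    proof -
      have "(\<integral>x. G x r \<partial>M) \<le> (\<integral>x. E (q n) x \<partial>M)"
      proof (rule integral_mono_AE[OF G_int E_int(1)])
        show "AE x in M. G x r \<le> E (q n) x"
          using H_eq[of "q n"] by eventually_elim (metis G_le q(1,2))
      qed
      then show ?thesis by (simp add: E_int)
    qed
    ultimately have "(\<integral>x. G x r \<partial>M) \<le> (\<integral>x. E r x \<partial>M)"
      unfolding E_int by (intro LIMSEQ_le_const) auto
    then have "(\<integral>x. G x r - E r x \<partial>M) \<le> 0"
      using G_int E_int(1) by simp
    moreover have "0 \<le> (\<integral>x. G x r - E r x \<partial>M)"
      using E_le by (intro integral_nonneg_AE) auto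
    ultimately have "(\<integral>x. G x r - E r x \<partial>M) = 0" by simp
    then have "AE x in M. G x r - E r x = 0"
      using integral_nonneg_eq_0_iff_AE[of M "\<lambda>x. G x r - E r x"] G_int E_int(1) E_le by auto
    then show ?thesis by eventually_elim auto
  qed
  have "cond_kernel M F borel k g"
  proof (rule cond_kernel_realI[OF M k g])
    fix A r assume A: "A \<in> sets F"
    then have "A \<in> sets M" using M(2) by (auto simp: subalgebra_def)
    have "(\<integral>x\<in>A. measure (g x) {..r} \<partial>M) = (\<integral>x\<in>A. E r x \<partial>M)"
      unfolding g_Iic
      by (rule set_lebesgue_integral_cong_AE) (use \<open>A \<in> sets M\<close> G_eq[of r] in auto)
    also have "\<dots> = (\<integral>x\<in>A. measure (k x) {..r} \<partial>M)"
      using real_cond_exp_intA[OF c_int A, of r] by (simp add: E_def c_def)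
    finally show "(\<integral>x\<in>A. measure (g x) {..r} \<partial>M) = (\<integral>x\<in>A. measure (k x) {..r} \<partial>M)" .
  qed
  then show "\<exists>g. cond_kernel M F borel k g" by (intro exI[of _ g])
qed

text \<open>The kernel is pushed to the reals along \<open>\<phi>\<close>, conditioned there, and
  brought back along \<open>\<psi>\<close>. As \<open>\<psi>\<close> is defined on all reals, the
  result is a probability measure even where \<open>g x\<close> charges reals that code no point;
  \<open>\<psi> (\<phi> y) = y\<close> returns each set \<open>C\<close> to itself. The bound
  \<open>4 / 3 < 2\<close> supplies the support condition.\<close>

lemma ex_cond_kernel_polish:
  fixes k :: "'a \<Rightarrow> 'b::polish_space measure"
  assumes M: "prob_space M" "subalgebra M F" and k: "k \<in> M \<rightarrow>\<^sub>M prob_algebra borel"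
  shows "\<exists>g. cond_kernel M F borel k g"
proof -
  obtain \<phi> :: "'b \<Rightarrow> real" and \<psi> :: "real \<Rightarrow> 'b" where
    [measurable]: "\<phi> \<in> borel_measurable borel" "\<psi> \<in> borel_measurable borel"
    and \<psi>\<phi>: "\<And>y. \<psi> (\<phi> y) = y" and \<phi>: "\<And>y. 0 \<le> \<phi> y" "\<And>y. \<phi> y \<le> 4 / 3"
    using polish_real_coding by metis
  define k' where "k' x = distr (k x) borel \<phi>" for x
  have k': "k' \<in> M \<rightarrow>\<^sub>M prob_algebra borel"
    unfolding k'_def using k by (rule measurable_compose[OF _ measurable_distr_prob_space]) simp
  have k'_measure: "measure (k' x) C = measure (k x) (\<phi> -` C)" if "x \<in> space M" "C \<in> sets borel" for x C
    unfolding k'_def using that kernel_space[OF k that(1)]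
    by (subst measure_distr) (auto cong: measurable_cong_sets)
  have "measure (k' x) {0..<2} = 1" if x: "x \<in> space M" for x
  proof -
    have "\<phi> y < 2" for y using \<phi>(2)[of y] by simp
    then have "\<phi> -` {0..<2} = space (k x)"
      using \<phi>(1) kernel_space(3)[OF k x] by auto
    then show ?thesis
      using k'_measure[OF x, of "{0..<2}"] prob_space.prob_space[OF kernel_space(1)[OF k x]] by simp
  qed
  then obtain g where g: "cond_kernel M F borel k' g"
    using ex_cond_kernel_real[OF M k'] by blast
  define g' where "g' x = distr (g x) borel \<psi>" for x
  have gF: "g \<in> F \<rightarrow>\<^sub>M prob_algebra borel" using g by (simp add: cond_kernel_def)
  have "g' \<in> F \<rightarrow>\<^sub>M prob_algebra borel"
    unfolding g'_def using gF by (rule measurable_compose[OF _ measurable_distr_prob_space]) simp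
  moreover have "(\<integral>x\<in>A. measure (g' x) C \<partial>M) = (\<integral>x\<in>A. measure (k x) C \<partial>M)"
    if A: "A \<in> sets F" and C: "C \<in> sets borel" for A C
  proof -
    have A': "A \<in> sets M" and sp: "\<And>x. x \<in> A \<Longrightarrow> x \<in> space M" "space F = space M"
      using A M(2) sets.sets_into_space by (auto simp: subalgebra_def)
    have C': "\<psi> -` C \<in> sets borel"
      using measurable_sets[of \<psi> borel borel C] C by simp
    have "(\<integral>x\<in>A. measure (g' x) C \<partial>M) = (\<integral>x\<in>A. measure (g x) (\<psi> -` C) \<partial>M)"
    proof (rule set_lebesgue_integral_cong[OF A'], intro allI impI)
      fix x assume "x \<in> A"
      then have x: "x \<in> space F" using sp by auto
      show "measure (g' x) C = measure (g x) (\<psi> -` C)"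
        unfolding g'_def using C kernel_space[OF gF x]
        by (subst measure_distr) (auto cong: measurable_cong_sets)
    qed
    also have "\<dots> = (\<integral>x\<in>A. measure (k' x) (\<psi> -` C) \<partial>M)"
      using g A C' by (simp add: cond_kernel_def)
    also have "\<dots> = (\<integral>x\<in>A. measure (k x) C \<partial>M)"
      using sp(1) C' by (intro set_lebesgue_integral_cong[OF A'])
        (auto simp: k'_measure \<psi>\<phi> vimage_def)
    finally show ?thesis .
  qed
  ultimately show ?thesis by (auto simp: cond_kernel_def)
qed

text \<open>With \<open>k\<close>, \<open>h\<close> the isomorphism to the standard Borel space, \<open>h \<circ> E[k | F]\<close> is a version of
  \<open>E[h \<circ> k | F]\<close>, and \<open>h \<circ> k\<close> is the identity.\<close>

lemma ex_cond_kernel_kid: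
  fixes M :: "'a measure"
  assumes M: "ess_standard_borel TYPE('b::polish_space) M" "subalgebra M F"
  shows "\<exists>e. cond_kernel M F M (kid M) e"
proof -
  have prob: "prob_space M" using M(1) by (simp add: ess_standard_borel_def)
  obtain N :: "'b measure" and k h where N: "sets N = sets borel"
    and k: "k \<in> M \<rightarrow>\<^sub>M prob_algebra N" and h: "h \<in> N \<rightarrow>\<^sub>M prob_algebra M"
    and hk: "kernel_ae_eq M M (kcomp h k) (kid M)"
    using M(1) unfolding ess_standard_borel_def standard_borel_prob_def GKrn_iso_def mp_kernel_def markov_kernel_def
    by blast
  \<comment> \<open>\<open>prob_algebra\<close> sees only the measurable sets of \<open>N\<close>,
    so the result for \<open>borel\<close> transfers.\<close>
  have [simp]: "prob_algebra N = prob_algebra borel" 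
    using subprob_algebra_cong[OF N] by (simp add: prob_algebra_def)
  have k': "k \<in> M \<rightarrow>\<^sub>M prob_algebra borel" using k by simp
  obtain g where g: "cond_kernel M F borel k g"
    using ex_cond_kernel_polish[OF prob M(2) k'] by blast
  then have gF: "g \<in> F \<rightarrow>\<^sub>M prob_algebra N" by (simp add: cond_kernel_def)
  have gM: "g \<in> M \<rightarrow>\<^sub>M prob_algebra N" by (rule measurable_from_subalg[OF M(2) gF])
  have gN: "cond_kernel M F N k g" using g N by (simp add: cond_kernel_def)
  have "kcomp h g \<in> F \<rightarrow>\<^sub>M prob_algebra M"
    unfolding kcomp_def by (rule measurable_bind_prob_space[OF gF h])
  moreover have "(\<integral>x\<in>A. measure (kcomp h g x) B \<partial>M) = (\<integral>x\<in>A. measure (kid M x) B \<partial>M)"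
    if A: "A \<in> sets F" and B: "B \<in> sets M" for A B
  proof -
    have A': "A \<in> sets M" and sp: "\<And>x. x \<in> A \<Longrightarrow> x \<in> space M"
      using A M(2) sets.sets_into_space by (auto simp: subalgebra_def)
    have hB: "(\<lambda>y. measure (h y) B) \<in> borel_measurable N" "\<And>y. y \<in> space N \<Longrightarrow> 0 \<le> measure (h y) B \<and> measure (h y) B \<le> 1"
      using kernel_measure_measurable[OF h B] prob_space.prob_le_1[OF kernel_space(1)[OF h]] by auto
    have "(\<integral>x\<in>A. measure (kcomp h g x) B \<partial>M) = (\<integral>x\<in>A. (\<integral>y. measure (h y) B \<partial>g x) \<partial>M)"
      by (intro set_lebesgue_integral_cong[OF A']) (auto simp: measure_kcomp[OF gM h _ B] sp)
    also have "\<dots> = (\<integral>x\<in>A. (\<integral>y. measure (h y) B \<partial>k x) \<partial>M)"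
      by (rule cond_kernel_integral[OF prob M(2) k gN A hB])
    also have "\<dots> = (\<integral>x\<in>A. measure (kcomp h k x) B \<partial>M)"
      by (intro set_lebesgue_integral_cong[OF A']) (auto simp: measure_kcomp[OF k h _ B] sp)
    also have "\<dots> = (\<integral>x\<in>A. measure (kid M x) B \<partial>M)"
    proof (rule set_lebesgue_integral_cong_AE[OF A'])
      have "kcomp h k \<in> M \<rightarrow>\<^sub>M prob_algebra M"
        unfolding kcomp_def by (rule measurable_bind_prob_space[OF k h])
      then show "(\<lambda>x. measure (kcomp h k x) B) \<in> borel_measurable M"
        by (rule kernel_measure_measurable[OF _ B])
      show "(\<lambda>x. measure (kid M x) B) \<in> borel_measurable M"
        unfolding kid_def by (rule kernel_measure_measurable[OF measurable_return_prob_space B])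
      show "AE x\<in>A in M. measure (kcomp h k x) B = measure (kid M x) B"
        using hk B by (auto simp: kernel_ae_eq_def)
    qed
    finally show ?thesis .
  qed
  ultimately show ?thesis by (auto simp: cond_kernel_def)
qed

section \<open>Dagger idempotents as conditional expectations\<close>

lemma set_lebesgue_integral_space:
  fixes u :: "'a \<Rightarrow> real"
  shows "(\<integral>x\<in>space M. u x \<partial>M) = (\<integral>x. u x \<partial>M)"
  unfolding set_lebesgue_integral_def by (intro Bochner_Integration.integral_cong) auto

lemma kid_measurable: "kid M \<in> M \<rightarrow>\<^sub>M prob_algebra M"
  unfolding kid_def by (rule measurable_return_prob_space)

lemma kernel_measure_bounds:
  assumes "k \<in> M \<rightarrow>\<^sub>M prob_algebra N" "x \<in> space M"
  shows "0 \<le> measure (k x) B \<and> measure (k x) B \<le> 1"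
  using prob_space.prob_le_1[OF kernel_space(1)[OF assms]] by simp

lemma kernel_measure_integrable:
  assumes "prob_space M" "k \<in> M \<rightarrow>\<^sub>M prob_algebra N" "B \<in> sets N"
  shows "integrable M (\<lambda>x. measure (k x) B)"
proof -
  interpret prob_space M by fact
  show ?thesis
    using kernel_measure_bounds[OF assms(2)] kernel_measure_measurable[OF assms(2,3)]
    by (intro integrable_const_bound[of _ 1]) auto
qed

lemma mp_kernel_integral:
  fixes f :: "'b \<Rightarrow> real"
  assumes M: "prob_space M" and e: "mp_kernel M M e"
    and f: "f \<in> borel_measurable M" "\<And>y. y \<in> space M \<Longrightarrow> 0 \<le> f y \<and> f y \<le> 1"
  shows "(\<integral>x. (\<integral>y. f y \<partial>e x) \<partial>M) = (\<integral>x. f x \<partial>M)"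
proof -
  have eM: "e \<in> M \<rightarrow>\<^sub>M prob_algebra M" using e by (simp add: mp_kernel_def markov_kernel_def)
  have kid: "(\<integral>x. measure (kid M x) C \<partial>M) = measure M C" if C: "C \<in> sets M" for C
  proof -
    have "(\<integral>x. measure (kid M x) C \<partial>M) = (\<integral>x. indicator C x \<partial>M)"
      using C by (intro Bochner_Integration.integral_cong) (auto simp: kid_def measure_return)
    then show ?thesis using C by simp
  qed
  have "(\<integral>x\<in>space M. (\<integral>y. f y \<partial>e x) \<partial>M) = (\<integral>x\<in>space M. (\<integral>y. f y \<partial>kid M x) \<partial>M)"
    using e by (intro set_integral_kernel_eq[OF M _ kid_measurable eM _ f]) (auto simp: set_lebesgue_integral_space kid mp_kernel_def)
  also have "\<dots> = (\<integral>x. f x \<partial>M)"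
    unfolding set_lebesgue_integral_space using f(1) by (intro Bochner_Integration.integral_cong) (auto simp: kid_def integral_return)
  finally show ?thesis by (simp add: set_lebesgue_integral_space)
qed

text \<open>The bridge to \<open>real_cond_exp\<close>: integrating \<open>f\<close> against
  \<open>e x\<close> is \<open>F\<close>-measurable in \<open>x\<close> and has the integrals of
  \<open>f\<close> over sets of \<open>F\<close>, which characterises the conditional
  expectation.\<close>

lemma cond_exp_kernel:
  fixes f :: "'a \<Rightarrow> real"
  assumes M: "prob_space M" "subalgebra M F" and e: "cond_kernel M F M (kid M) e"
    and f: "f \<in> borel_measurable M" "\<And>y. y \<in> space M \<Longrightarrow> 0 \<le> f y \<and> f y \<le> 1"
  shows "AE x in M. real_cond_exp M F f x = (\<integral>y. f y \<partial>e x)"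
proof -
  interpret prob_space M by fact
  interpret finite_measure_subalgebra M F by (rule finite_measure_subalgebraI[OF M])
  have eF: "e \<in> F \<rightarrow>\<^sub>M prob_algebra M" using e by (simp add: cond_kernel_def)
  have eM: "e \<in> M \<rightarrow>\<^sub>M prob_algebra M" by (rule measurable_from_subalg[OF M(2) eF])
  show ?thesis
  proof (rule real_cond_exp_charact)
    fix A assume A: "A \<in> sets F"
    then have A': "A \<in> sets M" using M(2) by (auto simp: subalgebra_def)
    have "(\<integral>x\<in>A. (\<integral>y. f y \<partial>e x) \<partial>M) = (\<integral>x\<in>A. (\<integral>y. f y \<partial>kid M x) \<partial>M)"
      by (rule cond_kernel_integral[OF M kid_measurable e A f])
    also have "\<dots> = (\<integral>x\<in>A. f x \<partial>M)"
      using sets.sets_into_space[OF A'] f(1)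
      by (intro set_lebesgue_integral_cong[OF A']) (auto simp: kid_def integral_return)
    finally show "(\<integral>x\<in>A. f x \<partial>M) = (\<integral>x\<in>A. (\<integral>y. f y \<partial>e x) \<partial>M)" by simp
  next
    show "integrable M f"
      using f by (intro integrable_const_bound[of _ 1]) auto
    show "integrable M (\<lambda>x. \<integral>y. f y \<partial>e x)"
      using kernel_integral_bounds[OF eM _ f] kernel_integral_measurable[OF eM f(1)]
      by (intro integrable_const_bound[of _ 1]) auto
    show "(\<lambda>x. \<integral>y. f y \<partial>e x) \<in> borel_measurable F"
      by (rule kernel_integral_measurable[OF eF f(1)])
  qed
qed

lemma cond_exp_kernel_indicator:
  assumes M: "prob_space M" "subalgebra M F" and e: "cond_kernel M F M (kid M) e"
    and B: "B \<in> sets M"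
  shows "AE x in M. real_cond_exp M F (indicator B) x = measure (e x) B"
proof -
  have eM: "e \<in> M \<rightarrow>\<^sub>M prob_algebra M"
    using e measurable_from_subalg[OF M(2)] by (auto simp: cond_kernel_def)
  have "AE x in M. real_cond_exp M F (indicator B) x = (\<integral>y. indicator B y \<partial>e x)"
    using B by (intro cond_exp_kernel[OF M e]) (auto split: split_indicator)
  moreover have "AE x in M. (\<integral>y. indicator B y \<partial>e x) = measure (e x) B"
  proof (rule AE_I2)
    fix x assume "x \<in> space M"
    then have "B \<inter> space (e x) = B"
      using kernel_space[OF eM] B sets.sets_into_space by blast
    then show "(\<integral>y. indicator B y \<partial>e x) = measure (e x) B" by simp
  qed
  ultimately show ?thesis by eventually_elim simp
qed

text \<open>Kernels act on functions in reverse order: \<open>kcomp h e\<close> moves points by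
  \<open>e\<close> first, hence applies \<open>h\<close> to the indicator of \<open>B\<close> first
  and conditions on \<open>F\<close> last.\<close>

lemma cond_exp_kcomp:
  assumes M: "prob_space M" "subalgebra M F" and e: "cond_kernel M F M (kid M) e"
    and h: "h \<in> M \<rightarrow>\<^sub>M prob_algebra M" and B: "B \<in> sets M"
  shows "AE x in M. measure (kcomp h e x) B = real_cond_exp M F (\<lambda>y. measure (h y) B) x"
proof -
  have eM: "e \<in> M \<rightarrow>\<^sub>M prob_algebra M"
    using e measurable_from_subalg[OF M(2)] by (auto simp: cond_kernel_def)
  have "AE x in M. real_cond_exp M F (\<lambda>y. measure (h y) B) x = (\<integral>y. measure (h y) B \<partial>e x)"
    by (rule cond_exp_kernel[OF M e kernel_measure_measurable[OF h B] kernel_measure_bounds[OF h]])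
  then show ?thesis
    using AE_space by eventually_elim (simp add: measure_kcomp[OF eM h _ B])
qed

text \<open>\<open>e(B | x)\<close> is measurable for the coarser \<open>F\<close>, hence for
  \<open>G\<close>, so conditioning on \<open>G\<close> leaves it unchanged.\<close>

lemma kcomp_coarser_finer:
  assumes M: "prob_space M" "subalgebra M F" "subalgebra M G" "sets F \<subseteq> sets G"
    and e: "cond_kernel M F M (kid M) e" and f: "cond_kernel M G M (kid M) f"
  shows "kernel_ae_eq M M (kcomp e f) e"
  unfolding kernel_ae_eq_def
proof
  interpret finite_measure_subalgebra M G by (rule finite_measure_subalgebraI[OF M(1,3)])
  fix B assume B: "B \<in> sets M"
  have eF: "e \<in> F \<rightarrow>\<^sub>M prob_algebra M" using e by (simp add: cond_kernel_def)
  have eM: "e \<in> M \<rightarrow>\<^sub>M prob_algebra M" by (rule measurable_from_subalg[OF M(2) eF])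
  have "subalgebra G F" using M(2-4) by (simp add: subalgebra_def)
  then have "(\<lambda>x. measure (e x) B) \<in> borel_measurable G"
    by (rule measurable_from_subalg[OF _ kernel_measure_measurable[OF eF B]])
  then have "AE x in M. real_cond_exp M G (\<lambda>x. measure (e x) B) x = measure (e x) B"
    by (rule real_cond_exp_F_meas[OF kernel_measure_integrable[OF M(1) eM B]])
  with cond_exp_kcomp[OF M(1,3) f eM B]
  show "AE x in M. measure (kcomp e f x) B = measure (e x) B"
    by eventually_elim simp
qed

text \<open>One equation is \<open>kcomp_coarser_finer\<close>, the other is the tower property of
  conditional expectation.\<close>

lemma idem_le_cond_kernel:
  assumes M: "prob_space M" "subalgebra M F" "subalgebra M G" "sets F \<subseteq> sets G"
    and e: "cond_kernel M F M (kid M) e" and f: "cond_kernel M G M (kid M) f"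
  shows "idem_le M e f"
  unfolding idem_le_def
proof
  show "kernel_ae_eq M M (kcomp e f) e"
    by (rule kcomp_coarser_finer[OF assms])
  interpret prob_space M by fact
  interpret finite_measure_subalgebra M F by (rule finite_measure_subalgebraI[OF M(1,2)])
  have fM: "f \<in> M \<rightarrow>\<^sub>M prob_algebra M"
    using f measurable_from_subalg[OF M(3)] by (auto simp: cond_kernel_def)
  show "kernel_ae_eq M M (kcomp f e) e"
    unfolding kernel_ae_eq_def
  proof
    fix B assume B: "B \<in> sets M"
    have FG: "subalgebra G F" using M(2-4) by (simp add: subalgebra_def)
    have "AE x in M. real_cond_exp M F (real_cond_exp M G (indicator B)) x = real_cond_exp M F (\<lambda>x. measure (f x) B) x"
      using cond_exp_kernel_indicator[OF M(1,3) f B] kernel_measure_measurable[OF fM B]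
      by (intro real_cond_exp_cong) auto
    moreover have "AE x in M. real_cond_exp M F (real_cond_exp M G (indicator B)) x = real_cond_exp M F (indicator B) x"
    proof (rule real_cond_exp_nested_subalg[OF M(3) FG])
      show "integrable M (indicator B :: 'a \<Rightarrow> real)"
        using B by (intro integrable_real_indicator) (auto simp: emeasure_eq_measure)
    qed
    ultimately show "AE x in M. measure (kcomp f e x) B = measure (e x) B"
      using cond_exp_kcomp[OF M(1,2) e fM B] cond_exp_kernel_indicator[OF M(1,2) e B]
      by eventually_elim simp
  qed
qed

text \<open>The factor \<open>measure (e x) A\<close> is \<open>G\<close>-measurable and can be
  pulled out of the conditioning on \<open>G\<close>. With \<open>F = G\<close> this yields
  self-adjointness, with \<open>A = B\<close> the orthogonality relations behind the L2
  estimates.\<close>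

lemma integral_product_cond_kernel:
  assumes M: "prob_space M" "subalgebra M F" "subalgebra M G" "sets F \<subseteq> sets G"
    and e: "cond_kernel M F M (kid M) e" and f: "cond_kernel M G M (kid M) f"
    and A: "A \<in> sets M" and B: "B \<in> sets M"
  shows "(\<integral>x. measure (e x) A * measure (f x) B \<partial>M) = (\<integral>x\<in>B. measure (e x) A \<partial>M)"
proof -
  interpret prob_space M by fact
  interpret finite_measure_subalgebra M G by (rule finite_measure_subalgebraI[OF M(1,3)])
  have eF: "e \<in> F \<rightarrow>\<^sub>M prob_algebra M" using e by (simp add: cond_kernel_def)
  have eM: "e \<in> M \<rightarrow>\<^sub>M prob_algebra M" by (rule measurable_from_subalg[OF M(2) eF])
  have fM: "f \<in> M \<rightarrow>\<^sub>M prob_algebra M"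
    using f measurable_from_subalg[OF M(3)] by (auto simp: cond_kernel_def)
  have "subalgebra G F" using M(2-4) by (simp add: subalgebra_def)
  then have eG: "(\<lambda>x. measure (e x) A) \<in> borel_measurable G"
    by (rule measurable_from_subalg[OF _ kernel_measure_measurable[OF eF A]])
  note [measurable] = kernel_measure_measurable[OF eM A] kernel_measure_measurable[OF fM B] B
  have "(\<integral>x. measure (e x) A * measure (f x) B \<partial>M)
      = (\<integral>x. measure (e x) A * real_cond_exp M G (indicator B) x \<partial>M)"
    using cond_exp_kernel_indicator[OF M(1,3) f B]
    by (intro integral_cong_AE) (auto elim!: eventually_mono)
  also have "\<dots> = (\<integral>x. measure (e x) A * indicator B x \<partial>M)"
  proof (rule real_cond_exp_intg(2)[OF _ eG])
    show "integrable M (\<lambda>x. measure (e x) A * indicator B x)"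
      using kernel_measure_bounds[OF eM]
      by (intro integrable_const_bound[of _ 1]) (auto split: split_indicator)
  qed auto
  finally show ?thesis by (simp add: set_lebesgue_integral_def mult.commute)
qed

text \<open>Testing on \<open>space M\<close> gives preservation of \<open>M\<close>, taking
  \<open>F\<close> as both algebras in \<open>kcomp_coarser_finer\<close> gives idempotency, and the
  symmetry of the product integral in \<open>A\<close> and \<open>B\<close> makes \<open>e\<close>
  its own Bayesian inverse.\<close>

lemma dagger_idem_cond_kernel:
  assumes M: "prob_space M" "subalgebra M F" and e: "cond_kernel M F M (kid M) e"
  shows "dagger_idem M e"
proof -
  interpret prob_space M by fact
  have eM: "e \<in> M \<rightarrow>\<^sub>M prob_algebra M"
    using e measurable_from_subalg[OF M(2)] by (auto simp: cond_kernel_def)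
  have "space M \<in> sets F" using M(2) by (metis sets.top subalgebra_def)
  then have "(\<integral>x. measure (e x) B \<partial>M) = measure M B" if B: "B \<in> sets M" for B
  proof -
    have "(\<integral>x. measure (e x) B \<partial>M) = (\<integral>x. measure (kid M x) B \<partial>M)"
    proof -
      have "(\<integral>x\<in>space M. measure (e x) B \<partial>M) = (\<integral>x\<in>space M. measure (kid M x) B \<partial>M)"
        using e \<open>space M \<in> sets F\<close> B by (simp add: cond_kernel_def)
      then show ?thesis unfolding set_lebesgue_integral_space .
    qed
    also have "\<dots> = (\<integral>x. indicator B x \<partial>M)"
      using B by (intro Bochner_Integration.integral_cong) (auto simp: kid_def measure_return)
    finally show ?thesis using B by simp
  qed
  then have mp: "mp_kernel M M e"
    using eM by (simp add: mp_kernel_def markov_kernel_def)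
  moreover have "kernel_ae_eq M M (kcomp e e) e"
    by (rule kcomp_coarser_finer[OF M M(2) order_refl e e])
  moreover have "bayes_inverse M M e e"
    unfolding bayes_inverse_def
  proof (intro conjI mp ballI)
    fix A B assume AB: "A \<in> sets M" "B \<in> sets M"
    have "(\<integral>x\<in>A. measure (e x) B \<partial>M) = (\<integral>x. measure (e x) B * measure (e x) A \<partial>M)"
      by (rule integral_product_cond_kernel[OF M M(2) order_refl e e AB(2,1), symmetric])
    also have "\<dots> = (\<integral>x. measure (e x) A * measure (e x) B \<partial>M)"
      by (simp only: mult.commute)
    also have "\<dots> = (\<integral>y\<in>B. measure (e y) A \<partial>M)"
      by (rule integral_product_cond_kernel[OF M M(2) order_refl e e AB])
    finally show "(\<integral>x\<in>A. measure (e x) B \<partial>M) = (\<integral>y\<in>B. measure (e y) A \<partial>M)" .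
  qed
  ultimately show ?thesis by (simp add: dagger_idem_def)
qed

section \<open>The \<sigma>-algebra of almost surely invariant sets\<close>

definition invariant_algebra :: "'a measure \<Rightarrow> ('a \<Rightarrow> 'a measure) \<Rightarrow> 'a measure" where
  "invariant_algebra M e = sigma (space M) {A\<in>sets M. AE x in M. measure (e x) A = indicator A x}"

lemma space_invariant_algebra [simp]: "space (invariant_algebra M e) = space M"
  by (auto simp: invariant_algebra_def space_measure_of_conv)

text \<open>For a countable union the exceptional null sets merge. Off them, either \<open>x\<close>
  lies in some \<open>A i\<close>, which already has full mass under \<open>e x\<close>, or every
  \<open>A i\<close> is null for \<open>e x\<close>.\<close>

lemma sets_invariant_algebra:
  assumes e: "e \<in> M \<rightarrow>\<^sub>M prob_algebra M"
  shows "sets (invariant_algebra M e) = {A\<in>sets M. AE x in M. measure (e x) A = indicator A x}"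
    (is "_ = ?I")
proof -
  have "sigma_algebra (space M) ?I"
    unfolding sigma_algebra_iff2
  proof (intro conjI ballI allI impI)
    show "?I \<subseteq> Pow (space M)" using sets.sets_into_space by auto
    show "{} \<in> ?I" by auto
    show "space M - A \<in> ?I" if A: "A \<in> ?I" for A
    proof -
      have "AE x in M. measure (e x) A = indicator A x" using A by auto
      then have "AE x in M. measure (e x) (space M - A) = indicator (space M - A) x"
        using AE_space
      proof eventually_elim
        case (elim x)
        interpret k: prob_space "e x" by (rule kernel_space(1)[OF e elim(2)])
        have "measure (e x) (space M - A) = 1 - measure (e x) A"
          using k.prob_compl[of A] A kernel_space[OF e elim(2)] by auto
        then show ?case using elim by (auto split: split_indicator)
      qed
      then show ?thesis using A by auto
    qed
    show "(\<Union>i. A i) \<in> ?I" if A: "range A \<subseteq> ?I" for A :: "nat \<Rightarrow> 'a set"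
    proof -
      have "AE x in M. \<forall>i. measure (e x) (A i) = indicator (A i) x"
        using A by (subst AE_all_countable) auto
      then have "AE x in M. measure (e x) (\<Union>i. A i) = indicator (\<Union>i. A i) x"
        using AE_space
      proof eventually_elim
        case (elim x)
        interpret k: prob_space "e x" by (rule kernel_space(1)[OF e elim(2)])
        have A': "A i \<in> sets (e x)" for i
          using A kernel_space[OF e elim(2)] by auto
        show ?case
        proof (cases "x \<in> (\<Union>i. A i)")
          case True
          then obtain i where i: "x \<in> A i" by auto
          then have "1 \<le> measure (e x) (\<Union>i. A i)"
            using elim(1) A' k.finite_measure_mono[of "A i" "\<Union>i. A i"] by auto
          then have "measure (e x) (\<Union>i. A i) = 1" by (intro antisym k.prob_le_1)
          then show ?thesis using True by simp
        next
          case False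
          then have "emeasure (e x) (A i) = 0" for i
            using elim(1) by (auto simp: k.emeasure_eq_measure)
          then have "emeasure (e x) (\<Union>i. A i) = 0"
            using A' by (intro emeasure_UN_eq_0) auto
          then show ?thesis using False by (simp add: measure_def)
        qed
      qed
      then show ?thesis using A by auto
    qed
  qed
  then show ?thesis
    unfolding invariant_algebra_def
    by (subst sets_measure_of) (auto simp: sigma_algebra.sigma_sets_eq dest: sets.sets_into_space)
qed

lemma subalgebra_invariant_algebra:
  "e \<in> M \<rightarrow>\<^sub>M prob_algebra M \<Longrightarrow> subalgebra M (invariant_algebra M e)"
  by (auto simp: subalgebra_def sets_invariant_algebra)

text \<open>If \<open>f\<close> is \<open>e\<close>-harmonic, the variance of \<open>f\<close> under \<open>e x\<close> equals \<open>(e f\<^sup>2 - f\<^sup>2) x\<close>,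
  which integrates to zero because \<open>e\<close> preserves \<open>M\<close>.\<close>

lemma harmonic_AE_constant:
  fixes f :: "'a \<Rightarrow> real"
  assumes M: "prob_space M" and e: "mp_kernel M M e"
    and f: "f \<in> borel_measurable M" "\<And>y. y \<in> space M \<Longrightarrow> 0 \<le> f y \<and> f y \<le> 1"
    and harm: "AE x in M. (\<integral>y. f y \<partial>e x) = f x"
  shows "AE x in M. AE y in e x. f y = f x"
proof -
  interpret prob_space M by fact
  have eM: "e \<in> M \<rightarrow>\<^sub>M prob_algebra M" using e by (simp add: mp_kernel_def markov_kernel_def)
  have f2: "(\<lambda>y. (f y)\<^sup>2) \<in> borel_measurable M" "\<And>y. y \<in> space M \<Longrightarrow> 0 \<le> (f y)\<^sup>2 \<and> (f y)\<^sup>2 \<le> 1"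
    using f by (auto simp: power_le_one)
  define v where "v x = (\<integral>y. (f y)\<^sup>2 \<partial>e x) - (f x)\<^sup>2" for x
  have v_eq: "AE x in M. (\<integral>y. (f y - f x)\<^sup>2 \<partial>e x) = v x \<and> integrable (e x) (\<lambda>y. (f y - f x)\<^sup>2)"
    using harm AE_space
  proof eventually_elim
    case (elim x)
    interpret k: prob_space "e x" by (rule kernel_space(1)[OF eM elim(2)])
    have i: "integrable (e x) f" "integrable (e x) (\<lambda>y. (f y)\<^sup>2)"
      using f(2) f2(2) by (auto intro!: kernel_integrable[OF eM elim(2) f(1), of 1] kernel_integrable[OF eM elim(2) f2(1), of 1])
    have eq: "(f y - f x)\<^sup>2 = (f y)\<^sup>2 - 2 * f x * f y + (f x)\<^sup>2" for y
      by (simp add: power2_diff)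
    show ?case
      unfolding eq v_def using i elim(1) k.prob_space by (auto simp: power2_eq_square)
  qed
  have int: "integrable M (\<lambda>x. \<integral>y. (f y)\<^sup>2 \<partial>e x)" "integrable M (\<lambda>x. (f x)\<^sup>2)"
    using kernel_integral_bounds[OF eM _ f2] kernel_integral_measurable[OF eM f2(1)] f2
    by (auto intro!: integrable_const_bound[of _ 1])
  have "AE x in M. 0 \<le> v x"
    using v_eq by eventually_elim (metis integral_nonneg_AE AE_I2 zero_le_power2)
  moreover have "(\<integral>x. v x \<partial>M) = 0"
    unfolding v_def using int mp_kernel_integral[OF M e f2] by simp
  moreover have "integrable M v"
    unfolding v_def[abs_def] using int by simp
  ultimately have "AE x in M. v x = 0"
    using integral_nonneg_eq_0_iff_AE by blast
  with v_eq show ?thesis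
  proof eventually_elim
    case (elim x)
    then have "AE y in e x. (f y - f x)\<^sup>2 = 0"
      using integral_nonneg_eq_0_iff_AE[of "e x" "\<lambda>y. (f y - f x)\<^sup>2"] by simp
    then show ?case by eventually_elim auto
  qed
qed

text \<open>Idempotency makes \<open>e(B | x)\<close> harmonic, so \<open>e x\<close> is a.s.
  concentrated on the level set through \<open>x\<close>; sublevel sets are then invariant, which is
  the measurability. For invariant \<open>A\<close>, the Bayes identity moves the integral over
  \<open>A\<close> to one of \<open>e(A | y)\<close> over \<open>B\<close>, where
  \<open>e(A | y)\<close> is a.s. the indicator of \<open>A\<close>.\<close>

lemma cond_kernel_invariant_algebra:
  assumes M: "prob_space M" and e: "dagger_idem M e"
  shows "cond_kernel M (invariant_algebra M e) M (kid M) e"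
proof -
  interpret prob_space M by fact
  have mp: "mp_kernel M M e" and idem: "kernel_ae_eq M M (kcomp e e) e" and dag: "bayes_inverse M M e e"
    using e by (auto simp: dagger_idem_def)
  have eM: "e \<in> M \<rightarrow>\<^sub>M prob_algebra M" using mp by (simp add: mp_kernel_def markov_kernel_def)
  note inv = sets_invariant_algebra[OF eM]
  have meas: "(\<lambda>x. measure (e x) B) \<in> borel_measurable (invariant_algebra M e)" if B: "B \<in> sets M" for B
    unfolding borel_measurable_iff_le
  proof
    fix c :: real
    let ?f = "\<lambda>x. measure (e x) B"
    let ?A = "{x\<in>space M. ?f x \<le> c}"
    note [measurable] = kernel_measure_measurable[OF eM B]
    have A: "?A \<in> sets M" by measurable
    have "AE x in M. (\<integral>y. ?f y \<partial>e x) = ?f x"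
      using idem B AE_space by (auto simp: kernel_ae_eq_def measure_kcomp[OF eM eM _ B] elim!: AE_mp)
    then have "AE x in M. AE y in e x. ?f y = ?f x"
      using kernel_measure_bounds[OF eM] by (intro harmonic_AE_constant[OF M mp]) auto
    then have "AE x in M. measure (e x) ?A = indicator ?A x"
      using AE_space
    proof eventually_elim
      case (elim x)
      interpret k: prob_space "e x" by (rule kernel_space(1)[OF eM elim(2)])
      note ks = kernel_space[OF eM elim(2)]
      have A': "?A \<in> sets (e x)" using A ks by simp
      show ?case
      proof (cases "?f x \<le> c")
        case True
        have "AE y in e x. y \<in> ?A"
          using elim(1) AE_space by eventually_elim (use True ks in auto)
        then show ?thesis using True elim(2) k.prob_eq_1[OF A'] by simp
      next
        case False
        have "AE y in e x. y \<notin> ?A"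
          using elim(1) by eventually_elim (use False in auto)
        then show ?thesis using False k.prob_eq_0[OF A'] by simp
      qed
    qed
    then show "{w \<in> space (invariant_algebra M e). ?f w \<le> c} \<in> sets (invariant_algebra M e)"
      using A by (simp add: inv)
  qed
  have "e \<in> invariant_algebra M e \<rightarrow>\<^sub>M prob_algebra M"
  proof (rule measurable_prob_algebra_generated[of _ "space M" "sets M"])
    fix A assume A: "A \<in> sets M"
    have "(\<lambda>x. ennreal (measure (e x) A)) \<in> borel_measurable (invariant_algebra M e)"
      using meas[OF A] by measurable
    moreover have "emeasure (e x) A = ennreal (measure (e x) A)" if "x \<in> space (invariant_algebra M e)" for x
    proof -
      interpret k: prob_space "e x" using that kernel_space(1)[OF eM] by simp
      show ?thesis by (rule k.emeasure_eq_measure)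
    qed
    ultimately show "(\<lambda>x. emeasure (e x) A) \<in> borel_measurable (invariant_algebra M e)"
      by (subst measurable_cong) auto
  qed (use kernel_space[OF eM] in \<open>auto simp: sets.sigma_sets_eq sets.Int_stable sets.space_closed\<close>)
  moreover have "(\<integral>x\<in>A. measure (e x) B \<partial>M) = (\<integral>x\<in>A. measure (kid M x) B \<partial>M)"
    if A: "A \<in> sets (invariant_algebra M e)" and B: "B \<in> sets M" for A B
  proof -
    have A': "A \<in> sets M" and AE_A: "AE x in M. measure (e x) A = indicator A x"
      using A by (auto simp: inv)
    have "(\<integral>x\<in>A. measure (e x) B \<partial>M) = (\<integral>y\<in>B. measure (e y) A \<partial>M)"
      using dag A' B by (simp add: bayes_inverse_def)
    also have "\<dots> = (\<integral>y\<in>B. indicator A y \<partial>M)"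
      using AE_A A' B kernel_measure_measurable[OF eM A'] by (intro set_lebesgue_integral_cong_AE) auto
    also have "\<dots> = (\<integral>x\<in>A. indicator B x \<partial>M)"
      by (simp add: set_lebesgue_integral_def mult.commute)
    also have "\<dots> = (\<integral>x\<in>A. measure (kid M x) B \<partial>M)"
      using sets.sets_into_space[OF A'] B
      by (intro set_lebesgue_integral_cong[OF A']) (auto simp: kid_def measure_return)
    finally show ?thesis .
  qed
  ultimately show ?thesis by (simp add: cond_kernel_def)
qed

text \<open>Conditional expectations ignore null sets, so \<open>e(B | x) = e(A | x)\<close> a.s.,
  which is the indicator of \<open>A\<close> and hence of \<open>B\<close>. Asking for a.s. rather
  than pointwise invariance is essential here.\<close>

lemma invariant_algebra_AE_closed:
  assumes M: "prob_space M" and e: "dagger_idem M e" and A: "A \<in> sets (invariant_algebra M e)"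
    and B: "B \<in> sets M" and AB: "AE x in M. x \<in> A \<longleftrightarrow> x \<in> B"
  shows "B \<in> sets (invariant_algebra M e)"
proof -
  have eM: "e \<in> M \<rightarrow>\<^sub>M prob_algebra M"
    using e by (auto simp: dagger_idem_def mp_kernel_def markov_kernel_def)
  have A': "A \<in> sets M" and AE_A: "AE x in M. measure (e x) A = indicator A x"
    using A by (auto simp: sets_invariant_algebra[OF eM])
  note sub = subalgebra_invariant_algebra[OF eM]
  interpret finite_measure_subalgebra M "invariant_algebra M e"
    by (rule finite_measure_subalgebraI[OF M sub])
  note ec = cond_kernel_invariant_algebra[OF M e]
  have ind: "AE x in M. indicator A x = (indicator B x :: real)"
    using AB by eventually_elim (simp add: indicator_def)
  then have "AE x in M. real_cond_exp M (invariant_algebra M e) (indicator A) x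
      = real_cond_exp M (invariant_algebra M e) (indicator B) x"
    using A' B by (intro real_cond_exp_cong) auto
  then have "AE x in M. measure (e x) B = indicator B x"
    using AE_A ind cond_exp_kernel_indicator[OF M sub ec A'] cond_exp_kernel_indicator[OF M sub ec B]
    by eventually_elim simp
  then show ?thesis using B by (simp add: sets_invariant_algebra[OF eM])
qed

text \<open>Evaluate \<open>kcomp e f = e\<close> on an \<open>e\<close>-invariant \<open>A\<close>:
  the left side is the conditional expectation of the indicator of \<open>A\<close>, that is
  \<open>f(A | x)\<close>, and the right side is that indicator.\<close>

lemma invariant_algebra_mono:
  assumes M: "prob_space M" and e: "dagger_idem M e" and f: "dagger_idem M f" and le: "idem_le M e f"
  shows "sets (invariant_algebra M e) \<subseteq> sets (invariant_algebra M f)"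
proof
  fix A assume A: "A \<in> sets (invariant_algebra M e)"
  have eM: "e \<in> M \<rightarrow>\<^sub>M prob_algebra M" and fM: "f \<in> M \<rightarrow>\<^sub>M prob_algebra M"
    using e f by (auto simp: dagger_idem_def mp_kernel_def markov_kernel_def)
  have A': "A \<in> sets M" and AE_A: "AE x in M. measure (e x) A = indicator A x"
    using A by (auto simp: sets_invariant_algebra[OF eM])
  note sub = subalgebra_invariant_algebra[OF fM]
  interpret finite_measure_subalgebra M "invariant_algebra M f"
    by (rule finite_measure_subalgebraI[OF M sub])
  note fc = cond_kernel_invariant_algebra[OF M f]
  have "AE x in M. real_cond_exp M (invariant_algebra M f) (\<lambda>x. measure (e x) A) x
      = real_cond_exp M (invariant_algebra M f) (indicator A) x"
    using AE_A A' kernel_measure_measurable[OF eM A'] by (intro real_cond_exp_cong) auto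
  moreover have "AE x in M. measure (kcomp e f x) A = measure (e x) A"
    using le A' by (auto simp: idem_le_def kernel_ae_eq_def)
  ultimately have "AE x in M. measure (f x) A = indicator A x"
    using AE_A cond_exp_kcomp[OF M sub fc eM A'] cond_exp_kernel_indicator[OF M sub fc A']
    by eventually_elim simp
  then show "A \<in> sets (invariant_algebra M f)"
    using A' by (simp add: sets_invariant_algebra[OF fM])
qed

section \<open>Convergence of monotone nets\<close>

text \<open>Integrability of \<open>\<phi>\<close> is part of the definition because the integral of
  a non-integrable function is 0 by convention, which would let false limits pass.\<close>

definition L1_net_limit :: "'a measure \<Rightarrow> ('i \<Rightarrow> 'i \<Rightarrow> bool) \<Rightarrow> ('i \<Rightarrow> 'a \<Rightarrow> real) \<Rightarrow> ('a \<Rightarrow> real) \<Rightarrow> bool" where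
  "L1_net_limit M le u \<phi> \<longleftrightarrow> integrable M \<phi> \<and>
     (\<forall>\<epsilon>>0. \<exists>i. \<forall>j. le i j \<longrightarrow> (\<integral>x. \<bar>\<phi> x - u j x\<bar> \<partial>M) < \<epsilon>)"

lemma integral_abs_triangle:
  fixes f g h :: "'a \<Rightarrow> real"
  assumes "integrable M f" "integrable M g" "integrable M h"
  shows "(\<integral>x. \<bar>f x - h x\<bar> \<partial>M) \<le> (\<integral>x. \<bar>f x - g x\<bar> \<partial>M) + (\<integral>x. \<bar>g x - h x\<bar> \<partial>M)"
proof -
  have "(\<integral>x. \<bar>f x - h x\<bar> \<partial>M) \<le> (\<integral>x. \<bar>f x - g x\<bar> + \<bar>g x - h x\<bar> \<partial>M)"
    using assms by (intro integral_mono) auto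
  then show ?thesis using assms by simp
qed

text \<open>Completeness of L1 for nets: indices with tail oscillation below
  \<open>1 / (n + 1)\<close> give a Cauchy sequence, a subsequence converges a.e., and the tail
  bounds carry its limit over to the whole net.\<close>

lemma ex_L1_net_limit:
  fixes u :: "'i \<Rightarrow> 'a \<Rightarrow> real"
  assumes M: "prob_space M" and le: "directed_preorder le"
    and u [measurable]: "\<And>i. u i \<in> borel_measurable M"
    and bounds: "\<And>i x. x \<in> space M \<Longrightarrow> 0 \<le> u i x \<and> u i x \<le> 1"
    and cauchy: "\<And>\<epsilon>. 0 < \<epsilon> \<Longrightarrow> \<exists>i. \<forall>j. le i j \<longrightarrow> (\<integral>x. \<bar>u i x - u j x\<bar> \<partial>M) < \<epsilon>"
  shows "\<exists>\<phi>. L1_net_limit M le u \<phi>"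
proof -
  interpret prob_space M by fact
  have int: "integrable M (u i)" for i
    using bounds by (intro integrable_const_bound[of _ 1]) auto
  have "\<forall>n. \<exists>i. \<forall>j. le i j \<longrightarrow> (\<integral>x. \<bar>u i x - u j x\<bar> \<partial>M) < 1 / real (Suc n)"
    using cauchy by simp
  then obtain i where i: "\<And>n j. le (i n) j \<Longrightarrow> (\<integral>x. \<bar>u (i n) x - u j x\<bar> \<partial>M) < 1 / real (Suc n)"
    by metis
  define s where "s n = u (i n)" for n
  \<comment> \<open>The chosen indices need not increase with \<open>n\<close>, so two of them are
    compared through a common upper bound \<open>j\<close>.\<close>
  have s_diff: "(\<integral>x. \<bar>s m x - s n x\<bar> \<partial>M) < 1 / real (Suc m) + 1 / real (Suc n)" for m n
  proof -
    obtain j where j: "le (i m) j" "le (i n) j" using le unfolding directed_preorder_def by blast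
    have "(\<integral>x. \<bar>u j x - u (i n) x\<bar> \<partial>M) = (\<integral>x. \<bar>u (i n) x - u j x\<bar> \<partial>M)"
      by (simp add: abs_minus_commute)
    then show ?thesis
      using i[OF j(1)] i[OF j(2)] integral_abs_triangle[OF int int int, of "i m" "i n" j]
      by (simp add: s_def)
  qed
  obtain r where r: "strict_mono r" "AE x in M. Cauchy (\<lambda>n. s (r n) x)"
  proof (rule cauchy_L1_AE_cauchy_subseq[of M s])
    show "integrable M (s n)" for n by (simp add: s_def int)
    fix \<epsilon> :: real assume "0 < \<epsilon>"
    then obtain N where N: "1 / real (Suc N) < \<epsilon> / 2"
      by (metis half_gt_zero nat_approx_posE)
    have "(\<integral>x. norm (s m x - s n x) \<partial>M) < \<epsilon>" if "m \<ge> N" "n \<ge> N" for m n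
    proof -
      have "1 / real (Suc m) \<le> 1 / real (Suc N)" "1 / real (Suc n) \<le> 1 / real (Suc N)"
        using that by (auto intro!: divide_left_mono)
      then have "1 / real (Suc m) + 1 / real (Suc n) < \<epsilon>" using N by linarith
      then show ?thesis using s_diff[of m n] by simp
    qed
    then show "\<exists>N. \<forall>i\<ge>N. \<forall>j\<ge>N. (\<integral>x. norm (s i x - s j x) \<partial>M) < \<epsilon>" by blast
  qed
  \<comment> \<open>Clipping changes nothing where the subsequence converges and keeps
    \<open>\<phi>\<close> bounded where \<open>lim\<close> is arbitrary.\<close>
  define \<phi> where "\<phi> x = max 0 (min 1 (lim (\<lambda>n. s (r n) x)))" for x
  have s_meas [measurable]: "s n \<in> borel_measurable M" for n by (simp add: s_def)
  have \<phi>_meas [measurable]: "\<phi> \<in> borel_measurable M" unfolding \<phi>_def by measurable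
  have \<phi>_int: "integrable M \<phi>"
    by (intro integrable_const_bound[of _ 1]) (auto simp: \<phi>_def)
  have "(\<lambda>n. \<integral>x. \<bar>\<phi> x - s (r n) x\<bar> \<partial>M) \<longlonglongrightarrow> (\<integral>x. 0 \<partial>M)"
  proof (rule integral_dominated_convergence[where w="\<lambda>_. 1"])
    show "AE x in M. (\<lambda>n. \<bar>\<phi> x - s (r n) x\<bar>) \<longlonglongrightarrow> 0"
      using r(2) AE_space
    proof eventually_elim
      case (elim x)
      then have lim: "(\<lambda>n. s (r n) x) \<longlonglongrightarrow> lim (\<lambda>n. s (r n) x)"
        by (simp add: convergent_LIMSEQ_iff[symmetric] Cauchy_convergent_iff)
      have "0 \<le> s n x" "s n x \<le> 1" for n using bounds[OF elim(2)] by (auto simp: s_def)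
      then have "0 \<le> lim (\<lambda>n. s (r n) x)" "lim (\<lambda>n. s (r n) x) \<le> 1"
        by (auto intro!: LIMSEQ_le_const[OF lim] LIMSEQ_le_const2[OF lim])
      then have "(\<lambda>n. s (r n) x) \<longlonglongrightarrow> \<phi> x" using lim by (simp add: \<phi>_def)
      then have "(\<lambda>n. \<bar>\<phi> x - s (r n) x\<bar>) \<longlonglongrightarrow> \<bar>\<phi> x - \<phi> x\<bar>" by (intro tendsto_intros)
      then show ?case by simp
    qed
    show "AE x in M. norm \<bar>\<phi> x - s (r n) x\<bar> \<le> 1" for n
    proof (rule AE_I2)
      fix x assume "x \<in> space M"
      then have "0 \<le> s (r n) x" "s (r n) x \<le> 1" using bounds by (auto simp: s_def)
      moreover have "0 \<le> \<phi> x" "\<phi> x \<le> 1" by (auto simp: \<phi>_def)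
      ultimately show "norm \<bar>\<phi> x - s (r n) x\<bar> \<le> 1" by simp
    qed
  qed auto
  then have lim0: "(\<lambda>n. \<integral>x. \<bar>\<phi> x - s (r n) x\<bar> \<partial>M) \<longlonglongrightarrow> 0" by simp
  have "\<exists>i. \<forall>j. le i j \<longrightarrow> (\<integral>x. \<bar>\<phi> x - u j x\<bar> \<partial>M) < \<epsilon>" if "0 < \<epsilon>" for \<epsilon>
  proof -
    obtain N where N: "1 / real (Suc N) < \<epsilon> / 2"
      using \<open>0 < \<epsilon>\<close> by (metis half_gt_zero nat_approx_posE)
    have "\<forall>\<^sub>F n in sequentially. (\<integral>x. \<bar>\<phi> x - s (r n) x\<bar> \<partial>M) < \<epsilon> / 2"
      using order_tendstoD(2)[OF lim0, of "\<epsilon> / 2"] \<open>0 < \<epsilon>\<close> by simp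
    then obtain n where n: "n \<ge> N" "(\<integral>x. \<bar>\<phi> x - s (r n) x\<bar> \<partial>M) < \<epsilon> / 2"
      by (metis (no_types, lifting) eventually_sequentially nle_le)
    have "N \<le> r n" using n(1) strict_mono_imp_increasing[OF r(1), of n] by linarith
    then have "1 / real (Suc (r n)) \<le> 1 / real (Suc N)" by (auto intro!: divide_left_mono)
    then have "(\<integral>x. \<bar>\<phi> x - u j x\<bar> \<partial>M) < \<epsilon>" if "le (i (r n)) j" for j
      using i[OF that] N n(2) integral_abs_triangle[OF \<phi>_int int int, of j "i (r n)"]
      by (simp add: s_def)
    then show ?thesis by blast
  qed
  with \<phi>_int show ?thesis by (auto simp: L1_net_limit_def)
qed

lemma (in sigma_finite_subalgebra) real_cond_exp_L1_contraction:
  assumes f: "integrable M f"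
  shows "(\<integral>x. \<bar>real_cond_exp M F f x\<bar> \<partial>M) \<le> (\<integral>x. \<bar>f x\<bar> \<partial>M)"
proof -
  have f': "integrable M (\<lambda>x. \<bar>f x\<bar>)" "integrable M (\<lambda>x. - 1 * f x)" using f by auto
  have "AE x in M. real_cond_exp M F f x \<le> real_cond_exp M F (\<lambda>x. \<bar>f x\<bar>) x"
    using f f' by (intro real_cond_exp_mono) auto
  moreover have "AE x in M. real_cond_exp M F (\<lambda>x. - 1 * f x) x \<le> real_cond_exp M F (\<lambda>x. \<bar>f x\<bar>) x"
    using f f' by (intro real_cond_exp_mono) auto
  moreover have "AE x in M. real_cond_exp M F (\<lambda>x. - 1 * f x) x = - 1 * real_cond_exp M F f x"
    by (rule real_cond_exp_cmult[OF f])
  ultimately have "AE x in M. \<bar>real_cond_exp M F f x\<bar> \<le> real_cond_exp M F (\<lambda>x. \<bar>f x\<bar>) x"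
    by eventually_elim auto
  then have "(\<integral>x. \<bar>real_cond_exp M F f x\<bar> \<partial>M) \<le> (\<integral>x. real_cond_exp M F (\<lambda>x. \<bar>f x\<bar>) x \<partial>M)"
    using real_cond_exp_int(1)[OF f] real_cond_exp_int(1)[OF f'(1)] by (intro integral_mono_AE) auto
  then show ?thesis using real_cond_exp_int(2)[OF f'(1)] by simp
qed

text \<open>Conditioning on \<open>G\<close> is an L1 contraction that fixes the late
  \<open>u j\<close>, so \<open>\<phi>\<close> and its conditional expectation are both close to the
  same \<open>u j\<close>. The conclusion is an a.e. fixed point because \<open>\<phi>\<close>
  itself is \<open>G\<close>-measurable only up to a null set.\<close>

lemma L1_net_limit_cond_exp:
  fixes u :: "'i \<Rightarrow> 'a \<Rightarrow> real"
  assumes M: "prob_space M" "subalgebra M G" and le: "directed_preorder le"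
    and \<phi>: "L1_net_limit M le u \<phi>" and u: "\<And>i. integrable M (u i)"
    and meas: "\<And>j. le i0 j \<Longrightarrow> u j \<in> borel_measurable G"
  shows "AE x in M. real_cond_exp M G \<phi> x = \<phi> x"
proof -
  interpret finite_measure_subalgebra M G by (rule finite_measure_subalgebraI[OF M])
  have \<phi>_int: "integrable M \<phi>" using \<phi> by (simp add: L1_net_limit_def)
  note E_int = real_cond_exp_int(1)[OF \<phi>_int]
  have "(\<integral>x. \<bar>real_cond_exp M G \<phi> x - \<phi> x\<bar> \<partial>M) \<le> 0 + \<epsilon>" if "0 < \<epsilon>" for \<epsilon>
  proof -
    have "0 < \<epsilon> / 2" using that by simp
    with \<phi> obtain i where i: "\<And>j. le i j \<Longrightarrow> (\<integral>x. \<bar>\<phi> x - u j x\<bar> \<partial>M) < \<epsilon> / 2"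
      unfolding L1_net_limit_def by blast
    obtain j where j: "le i j" "le i0 j" using le unfolding directed_preorder_def by blast
    have "AE x in M. real_cond_exp M G \<phi> x - u j x = real_cond_exp M G (\<lambda>x. \<phi> x - u j x) x"
      using real_cond_exp_diff[OF \<phi>_int u[of j]] real_cond_exp_F_meas[OF u meas[OF j(2)]]
      by eventually_elim simp
    then have "(\<integral>x. \<bar>real_cond_exp M G \<phi> x - u j x\<bar> \<partial>M) = (\<integral>x. \<bar>real_cond_exp M G (\<lambda>x. \<phi> x - u j x) x\<bar> \<partial>M)"
      using u[of j] by (intro integral_cong_AE) (auto elim!: eventually_mono)
    also have "\<dots> \<le> (\<integral>x. \<bar>\<phi> x - u j x\<bar> \<partial>M)"
      using \<phi>_int u by (intro real_cond_exp_L1_contraction) auto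
    finally have "(\<integral>x. \<bar>real_cond_exp M G \<phi> x - u j x\<bar> \<partial>M) < \<epsilon> / 2" using i[OF j(1)] by simp
    moreover have "(\<integral>x. \<bar>u j x - \<phi> x\<bar> \<partial>M) < \<epsilon> / 2"
      using i[OF j(1)] by (simp add: abs_minus_commute)
    ultimately show ?thesis
      using integral_abs_triangle[OF E_int u[of j] \<phi>_int] by simp
  qed
  then have "(\<integral>x. \<bar>real_cond_exp M G \<phi> x - \<phi> x\<bar> \<partial>M) \<le> 0"
    by (rule field_le_epsilon)
  moreover have "0 \<le> (\<integral>x. \<bar>real_cond_exp M G \<phi> x - \<phi> x\<bar> \<partial>M)" by simp
  ultimately have "(\<integral>x. \<bar>real_cond_exp M G \<phi> x - \<phi> x\<bar> \<partial>M) = 0" by simp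
  then have "AE x in M. \<bar>real_cond_exp M G \<phi> x - \<phi> x\<bar> = 0"
    using integral_nonneg_eq_0_iff_AE[of M "\<lambda>x. \<bar>real_cond_exp M G \<phi> x - \<phi> x\<bar>"] E_int \<phi>_int by simp
  then show ?thesis by eventually_elim simp
qed

text \<open>Integration over \<open>A\<close> is continuous in L1, and along the net it is
  eventually constant.\<close>

lemma L1_net_limit_set_integral:
  fixes u :: "'i \<Rightarrow> 'a \<Rightarrow> real"
  assumes le: "directed_preorder le"
    and \<phi>: "L1_net_limit M le u \<phi>" and u: "\<And>i. integrable M (u i)" and A: "A \<in> sets M"
    and c: "\<And>j. le i0 j \<Longrightarrow> (\<integral>x\<in>A. u j x \<partial>M) = c"
  shows "(\<integral>x\<in>A. \<phi> x \<partial>M) = c"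
proof -
  have \<phi>_int: "integrable M \<phi>" using \<phi> by (simp add: L1_net_limit_def)
  have "\<bar>(\<integral>x\<in>A. \<phi> x \<partial>M) - c\<bar> \<le> 0 + \<epsilon>" if "0 < \<epsilon>" for \<epsilon>
  proof -
    from that \<phi> obtain i where i: "\<And>j. le i j \<Longrightarrow> (\<integral>x. \<bar>\<phi> x - u j x\<bar> \<partial>M) < \<epsilon>"
      unfolding L1_net_limit_def by blast
    obtain j where j: "le i j" "le i0 j" using le unfolding directed_preorder_def by blast
    have int: "integrable M (\<lambda>x. indicator A x * \<phi> x)" "integrable M (\<lambda>x. indicator A x * u j x)"
      using integrable_mult_indicator[OF A \<phi>_int] integrable_mult_indicator[OF A u[of j]] by auto
    have "\<bar>(\<integral>x\<in>A. \<phi> x \<partial>M) - c\<bar> = \<bar>\<integral>x. indicator A x * \<phi> x - indicator A x * u j x \<partial>M\<bar>"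
      using int c[OF j(2)] by (simp add: set_lebesgue_integral_def)
    also have "\<dots> \<le> (\<integral>x. \<bar>indicator A x * \<phi> x - indicator A x * u j x\<bar> \<partial>M)"
      using integral_norm_bound[of M "\<lambda>x. indicator A x * \<phi> x - indicator A x * u j x"] by simp
    also have "\<dots> \<le> (\<integral>x. \<bar>\<phi> x - u j x\<bar> \<partial>M)"
      using int \<phi>_int u by (intro integral_mono) (auto split: split_indicator)
    finally show ?thesis using i[OF j(1)] by simp
  qed
  then have "\<bar>(\<integral>x\<in>A. \<phi> x \<partial>M) - c\<bar> \<le> 0" by (rule field_le_epsilon)
  then show ?thesis by simp
qed

text \<open>In L2, \<open>e\<close> applied to the indicator of \<open>B\<close> is the projection
  of \<open>f\<close> applied to it, so by Pythagoras the squared distance is exactly the difference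
  in \<open>less\<close>. The threshold \<open>\<epsilon>\<^sup>2\<close> is what makes the L1
  distance smaller than \<open>\<epsilon>\<close>.\<close>

lemma cond_kernel_L1_distance:
  assumes M: "prob_space M" "subalgebra M F" "subalgebra M G" "sets F \<subseteq> sets G"
    and e: "cond_kernel M F M (kid M) e" and f: "cond_kernel M G M (kid M) f"
    and B: "B \<in> sets M" and \<epsilon>: "0 < \<epsilon>"
    and less: "(\<integral>x\<in>B. measure (f x) B \<partial>M) - (\<integral>x\<in>B. measure (e x) B \<partial>M) < \<epsilon>\<^sup>2"
  shows "(\<integral>x. \<bar>measure (e x) B - measure (f x) B\<bar> \<partial>M) < \<epsilon>"
proof -
  interpret prob_space M by fact
  let ?e = "\<lambda>x. measure (e x) B" and ?f = "\<lambda>x. measure (f x) B"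
  have eM: "e \<in> M \<rightarrow>\<^sub>M prob_algebra M" and fM: "f \<in> M \<rightarrow>\<^sub>M prob_algebra M"
    using e f measurable_from_subalg[OF M(2)] measurable_from_subalg[OF M(3)] by (auto simp: cond_kernel_def)
  note [measurable] = kernel_measure_measurable[OF eM B] kernel_measure_measurable[OF fM B]
  have i: "integrable M (\<lambda>x. ?f x * ?f x)" "integrable M (\<lambda>x. ?e x * ?f x)" "integrable M (\<lambda>x. ?e x * ?e x)"
    using kernel_measure_bounds[OF eM] kernel_measure_bounds[OF fM]
    by (auto intro!: integrable_const_bound[of _ 1] AE_I2 mult_le_one)
  have eq: "(?e x - ?f x)\<^sup>2 = ?f x * ?f x - 2 * (?e x * ?f x) + ?e x * ?e x" for x
    by (simp add: power2_eq_square algebra_simps)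
  have sq_int: "integrable M (\<lambda>x. (?e x - ?f x)\<^sup>2)" unfolding eq using i by auto
  have "(\<integral>x. (?e x - ?f x)\<^sup>2 \<partial>M) = (\<integral>x. ?f x * ?f x \<partial>M) - 2 * (\<integral>x. ?e x * ?f x \<partial>M) + (\<integral>x. ?e x * ?e x \<partial>M)"
    unfolding eq using i by simp
  also have "\<dots> = (\<integral>x\<in>B. ?f x \<partial>M) - (\<integral>x\<in>B. ?e x \<partial>M)"
    using integral_product_cond_kernel[OF M(1,3,3) order_refl f f B B]
      integral_product_cond_kernel[OF M e f B B] integral_product_cond_kernel[OF M(1,2,2) order_refl e e B B]
    by simp
  finally have sq: "(\<integral>x. (?e x - ?f x)\<^sup>2 \<partial>M) < \<epsilon>\<^sup>2" using less by simp
  \<comment> \<open>AM-GM in place of the Cauchy--Schwarz inequality\<close>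
  have "\<bar>?e x - ?f x\<bar> \<le> (\<epsilon> + (?e x - ?f x)\<^sup>2 / \<epsilon>) / 2" for x
  proof -
    have "0 \<le> (\<epsilon> - \<bar>?e x - ?f x\<bar>)\<^sup>2" by simp
    then have "2 * \<epsilon> * \<bar>?e x - ?f x\<bar> \<le> \<epsilon>\<^sup>2 + (?e x - ?f x)\<^sup>2" by (simp add: power2_diff)
    then show ?thesis using \<epsilon> by (simp add: field_simps power2_eq_square)
  qed
  then have "(\<integral>x. \<bar>?e x - ?f x\<bar> \<partial>M) \<le> (\<integral>x. (\<epsilon> + (?e x - ?f x)\<^sup>2 / \<epsilon>) / 2 \<partial>M)"
    using sq_int kernel_measure_integrable[OF M(1) eM B] kernel_measure_integrable[OF M(1) fM B]
    by (intro integral_mono) auto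
  also have "\<dots> = (\<epsilon> + (\<integral>x. (?e x - ?f x)\<^sup>2 \<partial>M) / \<epsilon>) / 2"
    using sq_int by (simp add: prob_space)
  also have "\<dots> < (\<epsilon> + \<epsilon>\<^sup>2 / \<epsilon>) / 2"
    using sq \<epsilon> by (simp add: divide_strict_right_mono)
  also have "\<dots> = \<epsilon>" using \<epsilon> by (simp add: power2_eq_square)
  finally show ?thesis .
qed

text \<open>Applied to \<open>a\<close> for increasing nets and to \<open>- a\<close> for decreasing
  ones; the order of the indices enters only afterwards.\<close>

lemma ex_near_supremum:
  fixes a :: "'i \<Rightarrow> real"
  assumes "\<And>i. a i \<le> K" "0 < \<delta>"
  shows "\<exists>i. \<forall>j. a j - a i < \<delta>"
proof -
  have bdd: "bdd_above (range a)" using assms(1) by (auto intro!: bdd_aboveI2)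
  have "(SUP i. a i) - \<delta> < (SUP i. a i)" using assms(2) by simp
  then obtain i where i: "(SUP i. a i) - \<delta> < a i"
    using less_cSUP_iff[OF _ bdd] by auto
  have "a j - a i < \<delta>" for j using cSUP_upper[OF UNIV_I bdd, of j] i by simp
  then show ?thesis by blast
qed

section \<open>One-sided convergence of monotone nets of conditional kernels\<close>

lemma one_sided_convI:
  assumes "\<And>B \<epsilon>. B \<in> sets N \<Longrightarrow> 0 < \<epsilon> \<Longrightarrow>
    \<exists>i. \<forall>j. le i j \<longrightarrow> (\<integral>x. \<bar>measure (k x) B - measure (ks j x) B\<bar> \<partial>M) < \<epsilon>"
  shows "one_sided_conv M N le ks k"
  unfolding one_sided_conv_def
proof
  fix B assume B: "B \<in> sets N"
  show "((\<lambda>i. \<integral>x. \<bar>measure (k x) B - measure (ks i x) B\<bar> \<partial>M) \<longlongrightarrow> 0) (net_filter le)"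
  proof (rule order_tendstoI)
    fix a :: real assume "a < 0"
    then show "\<forall>\<^sub>F i in net_filter le. a < (\<integral>x. \<bar>measure (k x) B - measure (ks i x) B\<bar> \<partial>M)"
      by (intro always_eventually allI) (auto intro: less_le_trans)
  next
    fix a :: real assume "0 < a"
    then obtain i where i: "\<forall>j. le i j \<longrightarrow> (\<integral>x. \<bar>measure (k x) B - measure (ks j x) B\<bar> \<partial>M) < a"
      using assms[OF B] by blast
    have "net_filter le \<le> principal {j. le i j}"
      unfolding net_filter_def by (rule INF_lower) simp
    moreover have "\<forall>\<^sub>F j in principal {j. le i j}. (\<integral>x. \<bar>measure (k x) B - measure (ks j x) B\<bar> \<partial>M) < a"
      using i by (simp add: eventually_principal)
    ultimately show "\<forall>\<^sub>F i in net_filter le. (\<integral>x. \<bar>measure (k x) B - measure (ks i x) B\<bar> \<partial>M) < a"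
      by (rule filter_leD)
  qed
qed

text \<open>A net of conditional expectations that is monotone in either direction is Cauchy in \<open>L\<^sup>2\<close>,
  so all that remains is to identify its limit.\<close>

lemma one_sided_conv_cond_kernel:
  fixes es :: "'i \<Rightarrow> 'a \<Rightarrow> 'a measure"
  assumes M: "prob_space M" "subalgebra M F" and le: "directed_preorder le"
    and S: "\<And>i. subalgebra M (S i)" and es: "\<And>i. cond_kernel M (S i) M (kid M) (es i)"
    and e: "cond_kernel M F M (kid M) e"
    and mono: "(\<forall>i j. le i j \<longrightarrow> sets (S i) \<subseteq> sets (S j)) \<or> (\<forall>i j. le i j \<longrightarrow> sets (S j) \<subseteq> sets (S i))"
    and fixed: "\<And>B \<phi>. B \<in> sets M \<Longrightarrow> L1_net_limit M le (\<lambda>i x. measure (es i x) B) \<phi> \<Longrightarrow>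
       AE x in M. real_cond_exp M F \<phi> x = \<phi> x"
    and integral: "\<And>B \<phi> A. B \<in> sets M \<Longrightarrow> L1_net_limit M le (\<lambda>i x. measure (es i x) B) \<phi> \<Longrightarrow> A \<in> sets F \<Longrightarrow>
       (\<integral>x\<in>A. \<phi> x \<partial>M) = (\<integral>x\<in>A. measure (e x) B \<partial>M)"
  shows "one_sided_conv M M le es e"
proof (rule one_sided_convI)
  interpret prob_space M by fact
  interpret finite_measure_subalgebra M F by (rule finite_measure_subalgebraI[OF M])
  fix B and \<epsilon> :: real assume B: "B \<in> sets M" and \<epsilon>: "0 < \<epsilon>"
  have eF: "e \<in> F \<rightarrow>\<^sub>M prob_algebra M" using e by (simp add: cond_kernel_def)
  have eM: "e \<in> M \<rightarrow>\<^sub>M prob_algebra M" by (rule measurable_from_subalg[OF M(2) eF])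
  have esM: "es i \<in> M \<rightarrow>\<^sub>M prob_algebra M" for i
    using es[of i] measurable_from_subalg[OF S] by (auto simp: cond_kernel_def)
  \<comment> \<open>By \<open>integral_product_cond_kernel\<close> this is the squared L2 norm of
    the conditional probability of \<open>B\<close> given \<open>S i\<close>; it is therefore
    monotone in \<open>S i\<close>.\<close>
  define a where "a i = (\<integral>x\<in>B. measure (es i x) B \<partial>M)" for i
  have a: "0 \<le> a i" "a i \<le> 1" for i
  proof -
    have *: "0 \<le> indicator B x * measure (es i x) B" "indicator B x * measure (es i x) B \<le> 1" if "x \<in> space M" for x
      using kernel_measure_bounds[OF esM that, of i B] by (auto split: split_indicator)
    show "0 \<le> a i"
      unfolding a_def set_lebesgue_integral_def using * by (intro integral_nonneg_AE AE_I2) auto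
    have "integrable M (\<lambda>x. indicator B x * measure (es i x) B)"
      using integrable_mult_indicator[OF B kernel_measure_integrable[OF M(1) esM B]] by simp
    then have "a i \<le> (\<integral>x. 1 \<partial>M)"
      unfolding a_def set_lebesgue_integral_def using * by (intro integral_mono) auto
    then show "a i \<le> 1" by (simp add: prob_space)
  qed
  have cauchy: "\<exists>i. \<forall>j. le i j \<longrightarrow> (\<integral>x. \<bar>measure (es i x) B - measure (es j x) B\<bar> \<partial>M) < \<delta>" if \<delta>: "0 < \<delta>" for \<delta>
  proof -
    have \<delta>2: "0 < \<delta>\<^sup>2" using \<delta> by simp
    from mono show ?thesis
    proof
      assume mono: "\<forall>i j. le i j \<longrightarrow> sets (S i) \<subseteq> sets (S j)"
      obtain i where i: "\<forall>j. a j - a i < \<delta>\<^sup>2"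
        using ex_near_supremum[of a 1, OF a(2) \<delta>2] by blast
      have "(\<integral>x. \<bar>measure (es i x) B - measure (es j x) B\<bar> \<partial>M) < \<delta>" if "le i j" for j
        using cond_kernel_L1_distance[OF M(1) S S _ es es B \<delta>, of i j] i mono that by (auto simp: a_def)
      then show ?thesis by blast
    next
      assume mono: "\<forall>i j. le i j \<longrightarrow> sets (S j) \<subseteq> sets (S i)"
      \<comment> \<open>Now \<open>a\<close> decreases along the net, so \<open>i\<close> is nearly
        minimal; the later algebra is the coarser one, and the two indices change places.\<close>
      obtain i where i: "\<forall>j. - a j - - a i < \<delta>\<^sup>2"
        using ex_near_supremum[of "\<lambda>i. - a i" 0, OF _ \<delta>2] a(1) by auto
      have "(\<integral>x. \<bar>measure (es i x) B - measure (es j x) B\<bar> \<partial>M) < \<delta>" if "le i j" for j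
        using cond_kernel_L1_distance[OF M(1) S S _ es es B \<delta>, of j i] i mono that
        by (auto simp: a_def abs_minus_commute)
      then show ?thesis by blast
    qed
  qed
  obtain \<phi> where \<phi>: "L1_net_limit M le (\<lambda>i x. measure (es i x) B) \<phi>"
    using ex_L1_net_limit[OF M(1) le kernel_measure_measurable[OF esM B] kernel_measure_bounds[OF esM] cauchy]
    by blast
  have \<phi>_int: "integrable M \<phi>" using \<phi> by (simp add: L1_net_limit_def)
  \<comment> \<open>Equal integrals over sets of \<open>F\<close> identify only the conditional
    expectation of \<open>\<phi>\<close>; \<open>fixed\<close> then replaces it by
    \<open>\<phi>\<close>.\<close>
  have "AE x in M. real_cond_exp M F \<phi> x = measure (e x) B"
    by (rule real_cond_exp_charact[OF integral[OF B \<phi>] \<phi>_int kernel_measure_integrable[OF M(1) eM B]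
          kernel_measure_measurable[OF eF B]])
  with fixed[OF B \<phi>] have eq: "AE x in M. \<phi> x = measure (e x) B" by eventually_elim simp
  have "(\<integral>x. \<bar>measure (e x) B - measure (es j x) B\<bar> \<partial>M) = (\<integral>x. \<bar>\<phi> x - measure (es j x) B\<bar> \<partial>M)" for j
    using eq kernel_measure_measurable[OF eM B] kernel_measure_measurable[OF esM B] \<phi>_int
    by (intro integral_cong_AE) auto
  then show "\<exists>i. \<forall>j. le i j \<longrightarrow> (\<integral>x. \<bar>measure (e x) B - measure (es j x) B\<bar> \<partial>M) < \<epsilon>"
    using \<phi> \<epsilon> by (simp add: L1_net_limit_def)
qed

lemma two_sided_conv_dagger:
  assumes "one_sided_conv M M le es e" "\<And>i. dagger_idem M (es i)" "dagger_idem M e"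
  shows "two_sided_conv M M le es e"
  unfolding two_sided_conv_def using assms by (auto simp: dagger_idem_def)

text \<open>For \<open>A\<close> in some \<open>S i\<close>, all later \<open>es j\<close> have the
  same integral over \<open>A\<close> as \<open>e\<close>, namely
  \<open>measure M (A \<inter> B)\<close>, so the limit has it too. Directedness makes the union of
  the \<open>S i\<close> stable under intersection, and Dynkin induction reaches all of
  \<open>F\<close>.\<close>

lemma increasing_net_conv:
  fixes es :: "'i \<Rightarrow> 'a \<Rightarrow> 'a measure"
  assumes M: "prob_space M" and le: "directed_preorder le"
    and S: "\<And>i. subalgebra M (S i)" and es: "\<And>i. cond_kernel M (S i) M (kid M) (es i)"
    and mono: "\<And>i j. le i j \<Longrightarrow> sets (S i) \<subseteq> sets (S j)"
    and F: "subalgebra M F" "sets F = sigma_sets (space M) (\<Union>i. sets (S i))"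
    and e: "cond_kernel M F M (kid M) e"
  shows "one_sided_conv M M le es e"
proof (rule one_sided_conv_cond_kernel[OF M F(1) le S es e])
  interpret prob_space M by fact
  have SF: "sets (S i) \<subseteq> sets F" for i
    unfolding F(2) by (auto intro: sigma_sets.Basic)
  have esS: "es i \<in> S i \<rightarrow>\<^sub>M prob_algebra M" for i using es[of i] by (simp add: cond_kernel_def)
  have esM: "es i \<in> M \<rightarrow>\<^sub>M prob_algebra M" for i by (rule measurable_from_subalg[OF S esS])
  have eM: "e \<in> M \<rightarrow>\<^sub>M prob_algebra M"
    using e measurable_from_subalg[OF F(1)] by (auto simp: cond_kernel_def)
  show "(\<forall>i j. le i j \<longrightarrow> sets (S i) \<subseteq> sets (S j)) \<or> (\<forall>i j. le i j \<longrightarrow> sets (S j) \<subseteq> sets (S i))"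
    using mono by blast
  fix B \<phi> assume B: "B \<in> sets M" and \<phi>: "L1_net_limit M le (\<lambda>i x. measure (es i x) B) \<phi>"
  have \<phi>_int: "integrable M \<phi>" using \<phi> by (simp add: L1_net_limit_def)
  have u_int: "integrable M (\<lambda>x. measure (es i x) B)" for i
    by (rule kernel_measure_integrable[OF M esM B])
  show "AE x in M. real_cond_exp M F \<phi> x = \<phi> x"
  proof (rule L1_net_limit_cond_exp[OF M F(1) le \<phi> u_int])
    fix j
    have "subalgebra F (S j)" using S[of j] F(1) SF by (simp add: subalgebra_def)
    then show "(\<lambda>x. measure (es j x) B) \<in> borel_measurable F"
      by (rule measurable_from_subalg[OF _ kernel_measure_measurable[OF esS B]])
  qed
  let ?e = "\<lambda>x. measure (e x) B"
  have e_int: "integrable M ?e" by (rule kernel_measure_integrable[OF M eM B])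
  have eq_S: "(\<integral>x\<in>A. \<phi> x \<partial>M) = (\<integral>x\<in>A. ?e x \<partial>M)" if A: "A \<in> sets (S i)" for A i
  proof (rule L1_net_limit_set_integral[OF le \<phi> u_int])
    show "A \<in> sets M" using A S[of i] by (auto simp: subalgebra_def)
    fix j assume "le i j"
    then have "A \<in> sets (S j)" using mono A by blast
    then show "(\<integral>x\<in>A. measure (es j x) B \<partial>M) = (\<integral>x\<in>A. ?e x \<partial>M)"
      using e es[of j] SF[of j] B by (auto simp: cond_kernel_def)
  qed
  \<comment> \<open>Any index will do; equality of the total integrals is what the complement step
    of the induction needs.\<close>
  have "space M \<in> sets (S undefined)" using S by (metis sets.top subalgebra_def)
  from eq_S[OF this] have total: "(\<integral>x. \<phi> x \<partial>M) = (\<integral>x. ?e x \<partial>M)" unfolding set_lebesgue_integral_space .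
  have set_int: "set_integrable M A u" if "A \<in> sets M" "integrable M u" for A and u :: "'a \<Rightarrow> real"
    unfolding set_integrable_def using integrable_mult_indicator[OF that] by simp
  fix A assume "A \<in> sets F"
  then have A: "A \<in> sigma_sets (space M) (\<Union>i. sets (S i))" by (simp add: F(2))
  have stable: "Int_stable (\<Union>i. sets (S i))"
  proof (rule Int_stableI)
    fix a b assume "a \<in> (\<Union>i. sets (S i))" "b \<in> (\<Union>i. sets (S i))"
    then obtain i j where ij: "a \<in> sets (S i)" "b \<in> sets (S j)" by blast
    obtain k where "le i k" "le j k" using le unfolding directed_preorder_def by blast
    then have "a \<inter> b \<in> sets (S k)" using ij mono[of i k] mono[of j k] by blast
    then show "a \<inter> b \<in> (\<Union>i. sets (S i))" by blast
  qed
  have closed: "(\<Union>i. sets (S i)) \<subseteq> Pow (space M)"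
    using S sets.sets_into_space by (fastforce simp: subalgebra_def)
  have sM: "D \<in> sets M" if "D \<in> sigma_sets (space M) (\<Union>i. sets (S i))" for D
    using that F by (auto simp: subalgebra_def)
  show "(\<integral>x\<in>A. \<phi> x \<partial>M) = (\<integral>x\<in>A. ?e x \<partial>M)"
    using A
  proof (induction rule: sigma_sets_induct_disjoint[OF stable closed, consumes 1, case_names basic empty compl union])
    case (basic D)
    then show ?case using eq_S by blast
  next
    case empty
    show ?case by (simp add: set_lebesgue_integral_def)
  next
    case (compl D)
    have D: "D \<in> sets M" using compl(1) sM by blast
    have "(\<integral>x\<in>space M - D. u x \<partial>M) = (\<integral>x. u x \<partial>M) - (\<integral>x\<in>D. u x \<partial>M)" if u: "integrable M u" for u :: "'a \<Rightarrow> real"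
    proof -
      have "(\<integral>x\<in>D \<union> (space M - D). u x \<partial>M) = (\<integral>x\<in>D. u x \<partial>M) + (\<integral>x\<in>space M - D. u x \<partial>M)"
        using D u by (intro set_integral_Un set_int) auto
      moreover have "D \<union> (space M - D) = space M" using sets.sets_into_space[OF D] by auto
      ultimately show ?thesis by (simp add: set_lebesgue_integral_space)
    qed
    then show ?case using compl(2) total \<phi>_int e_int by simp
  next
    case (union D)
    have D: "D i \<in> sets M" for i using union(2) sM by blast
    have "(\<integral>x\<in>(\<Union>i. D i). u x \<partial>M) = (\<Sum>i. (\<integral>x\<in>D i. u x \<partial>M))" if u: "integrable M u" for u :: "'a \<Rightarrow> real"
      using D u union(1) by (intro lebesgue_integral_countable_add set_int) (auto simp: disjoint_family_on_def)
    then show ?case using union(3) \<phi>_int e_int by simp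
  qed
qed

text \<open>For each \<open>i\<close> the limit \<open>\<phi>\<close> is a.s. equal to a function
  measurable for the \<open>i\<close>-th algebra, with a null set depending on \<open>i\<close>.
  Closure of invariant algebras under a.s. equality puts the sublevel sets of the one function
  \<open>\<phi>\<close> into all of them, hence into \<open>F\<close>. This is why the lemma speaks
  of invariant algebras and not of an arbitrary decreasing family.\<close>

lemma decreasing_net_conv:
  fixes es :: "'i \<Rightarrow> 'a \<Rightarrow> 'a measure"
  assumes M: "prob_space M" and le: "directed_preorder le"
    and es: "\<And>i. dagger_idem M (es i)"
    and mono: "\<And>i j. le i j \<Longrightarrow> sets (invariant_algebra M (es j)) \<subseteq> sets (invariant_algebra M (es i))"
    and F: "subalgebra M F" "sets F = (\<Inter>i. sets (invariant_algebra M (es i)))"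
    and e: "cond_kernel M F M (kid M) e"
  shows "one_sided_conv M M le es e"
proof (rule one_sided_conv_cond_kernel[OF M F(1) le _ _ e])
  let ?S = "\<lambda>i. invariant_algebra M (es i)"
  have esM: "es i \<in> M \<rightarrow>\<^sub>M prob_algebra M" for i
    using es[of i] by (auto simp: dagger_idem_def mp_kernel_def markov_kernel_def)
  show S: "subalgebra M (?S i)" and ck: "cond_kernel M (?S i) M (kid M) (es i)" for i
    using subalgebra_invariant_algebra[OF esM] cond_kernel_invariant_algebra[OF M es] by auto
  show "(\<forall>i j. le i j \<longrightarrow> sets (?S i) \<subseteq> sets (?S j)) \<or> (\<forall>i j. le i j \<longrightarrow> sets (?S j) \<subseteq> sets (?S i))"
    using mono by blast
  fix B \<phi> assume B: "B \<in> sets M" and \<phi>: "L1_net_limit M le (\<lambda>i x. measure (es i x) B) \<phi>"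
  have \<phi>_int [measurable]: "integrable M \<phi>" using \<phi> by (simp add: L1_net_limit_def)
  have u_int: "integrable M (\<lambda>x. measure (es i x) B)" for i
    by (rule kernel_measure_integrable[OF M esM B])
  show "AE x in M. real_cond_exp M F \<phi> x = \<phi> x"
  proof -
    interpret finite_measure_subalgebra M F by (rule finite_measure_subalgebraI[OF M F(1)])
    have "{x\<in>space M. \<phi> x \<le> c} \<in> sets (?S i)" for c i
    proof -
      have "AE x in M. real_cond_exp M (?S i) \<phi> x = \<phi> x"
      proof (rule L1_net_limit_cond_exp[OF M S le \<phi> u_int])
        fix j assume "le i j"
        then have "subalgebra (?S i) (?S j)" using mono by (simp add: subalgebra_def)
        moreover have "es j \<in> ?S j \<rightarrow>\<^sub>M prob_algebra M" using ck[of j] by (simp add: cond_kernel_def)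
        ultimately show "(\<lambda>x. measure (es j x) B) \<in> borel_measurable (?S i)"
          by (intro measurable_from_subalg[OF _ kernel_measure_measurable[OF _ B]])
      qed
      then have AE_eq: "AE x in M. x \<in> {x\<in>space M. real_cond_exp M (?S i) \<phi> x \<le> c} \<longleftrightarrow> x \<in> {x\<in>space M. \<phi> x \<le> c}"
        by eventually_elim simp
      have "{x\<in>space (?S i). real_cond_exp M (?S i) \<phi> x \<le> c} \<in> sets (?S i)" by measurable
      then have "{x\<in>space M. real_cond_exp M (?S i) \<phi> x \<le> c} \<in> sets (?S i)"
        unfolding space_invariant_algebra .
      moreover have "{x\<in>space M. \<phi> x \<le> c} \<in> sets M" by measurable
      ultimately show ?thesis
        by (rule invariant_algebra_AE_closed[OF M es _ _ AE_eq])
    qed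
    then have "\<phi> \<in> borel_measurable F"
      using F by (simp add: borel_measurable_iff_le subalgebra_def)
    then show ?thesis by (rule real_cond_exp_F_meas[OF \<phi>_int])
  qed
  fix A assume A: "A \<in> sets F"
  show "(\<integral>x\<in>A. \<phi> x \<partial>M) = (\<integral>x\<in>A. measure (e x) B \<partial>M)"
  proof (rule L1_net_limit_set_integral[OF le \<phi> u_int])
    show "A \<in> sets M" using A F(1) by (auto simp: subalgebra_def)
    show "(\<integral>x\<in>A. measure (es j x) B \<partial>M) = (\<integral>x\<in>A. measure (e x) B \<partial>M)" for j
      using A F(2) e ck[of j] B by (auto simp: cond_kernel_def)
  qed
qed

section \<open>Suprema and infima of monotone nets of dagger idempotents\<close>

theorem theorem6p9:
  fixes M :: "'a measure" and le :: "'i \<Rightarrow> 'i \<Rightarrow> bool"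
    and es :: "'i \<Rightarrow> 'a \<Rightarrow> 'a measure"
  assumes "ess_standard_borel TYPE('b::polish_space) M"
    and "directed_preorder le"
    and "\<forall>i. dagger_idem M (es i)"
  shows
    "((\<forall>i j. le i j \<longrightarrow> idem_le M (es i) (es j)) \<and>
     (\<exists>u. dagger_idem M u \<and> (\<forall>i. idem_le M (es i) u)) \<longrightarrow>
       (\<exists>e. dagger_idem M e \<and> (\<forall>i. idem_le M (es i) e) \<and>
          (\<forall>g. dagger_idem M g \<and> (\<forall>i. idem_le M (es i) g) \<longrightarrow> idem_le M e g) \<and>
          two_sided_conv M M le es e)) \<and>
     ((\<forall>i j. le i j \<longrightarrow> idem_le M (es j) (es i)) \<and>
     (\<exists>l. dagger_idem M l \<and> (\<forall>i. idem_le M l (es i))) \<longrightarrow>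
       (\<exists>e. dagger_idem M e \<and> (\<forall>i. idem_le M e (es i)) \<and>
          (\<forall>g. dagger_idem M g \<and> (\<forall>i. idem_le M g (es i)) \<longrightarrow> idem_le M g e) \<and>
          two_sided_conv M M le es e))"
proof -
  have M: "prob_space M" using assms(1) by (simp add: ess_standard_borel_def)
  have es: "dagger_idem M (es i)" for i using assms(3) by blast
  have kernel: "g \<in> M \<rightarrow>\<^sub>M prob_algebra M" if "dagger_idem M g" for g
    using that by (auto simp: dagger_idem_def mp_kernel_def markov_kernel_def)
  let ?S = "\<lambda>i. invariant_algebra M (es i)"
  note sub = subalgebra_invariant_algebra[OF kernel]
  note ck = cond_kernel_invariant_algebra[OF M]
  note inv_mono = invariant_algebra_mono[OF M]
  show ?thesis
  proof (intro conjI impI; elim conjE)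
    assume inc: "\<forall>i j. le i j \<longrightarrow> idem_le M (es i) (es j)"
    define F where "F = sigma (space M) (\<Union>i. sets (?S i))"
    have gen: "(\<Union>i. sets (?S i)) \<subseteq> sets M" using sub[OF es] by (auto simp: subalgebra_def)
    have sets_F: "sets F = sigma_sets (space M) (\<Union>i. sets (?S i))"
      unfolding F_def using gen sets.space_closed by (intro sets_measure_of) blast
    have F: "subalgebra M F"
      using sets.sigma_sets_subset[OF gen] sets_F
      by (auto simp: subalgebra_def F_def space_measure_of_conv)
    have SF: "sets (?S i) \<subseteq> sets F" for i
      unfolding sets_F by (auto intro: sigma_sets.Basic)
    \<comment> \<open>The invariant algebra of \<open>e\<close> may exceed \<open>F\<close> by null
      sets; the comparisons below work with \<open>F\<close> directly, so the two are never
      identified.\<close>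
    obtain e where e: "cond_kernel M F M (kid M) e"
      using ex_cond_kernel_kid[OF assms(1) F] by blast
    have dagger: "dagger_idem M e" by (rule dagger_idem_cond_kernel[OF M F e])
    have "one_sided_conv M M le es e"
      by (rule increasing_net_conv[OF M assms(2) sub[OF es] ck[OF es] _ F sets_F e])
        (use inc inv_mono[OF es es] in blast)
    then have "two_sided_conv M M le es e" by (rule two_sided_conv_dagger[OF _ es dagger])
    moreover have "idem_le M (es i) e" for i
      by (rule idem_le_cond_kernel[OF M sub[OF es] F SF ck[OF es] e])
    moreover have "idem_le M e g" if g: "dagger_idem M g" "\<forall>i. idem_le M (es i) g" for g
    proof (rule idem_le_cond_kernel[OF M F sub[OF g(1)] _ e ck[OF g(1)]])
      have "(\<Union>i. sets (?S i)) \<subseteq> sets (invariant_algebra M g)"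
        using inv_mono[OF es g(1)] g(2) by blast
      then show "sets F \<subseteq> sets (invariant_algebra M g)"
        using sets.sigma_sets_subset[of _ "invariant_algebra M g"] by (simp add: sets_F)
    qed
    ultimately show "\<exists>e. dagger_idem M e \<and> (\<forall>i. idem_le M (es i) e) \<and>
          (\<forall>g. dagger_idem M g \<and> (\<forall>i. idem_le M (es i) g) \<longrightarrow> idem_le M e g) \<and>
          two_sided_conv M M le es e"
      using dagger by blast
  next
    assume dec: "\<forall>i j. le i j \<longrightarrow> idem_le M (es j) (es i)"
    define F where "F = sigma (space M) (\<Inter>i. sets (?S i))"
    have "sigma_algebra (space M) (\<Inter>i. sets (?S i))"
      unfolding sigma_algebra_iff2
    proof (intro conjI ballI allI impI)
      show "(\<Inter>i. sets (?S i)) \<subseteq> Pow (space M)"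
        using sets.space_closed[of "?S undefined"] by auto
      show "space M - A \<in> (\<Inter>i. sets (?S i))" if "A \<in> (\<Inter>i. sets (?S i))" for A
        using that sets.compl_sets[of A "?S _"] by auto
    qed auto
    then have sets_F: "sets F = (\<Inter>i. sets (?S i))"
      unfolding F_def by (simp add: sigma_algebra.sets_measure_of_eq)
    have F: "subalgebra M F"
      using sets_F sub[OF es] by (auto simp: subalgebra_def F_def space_measure_of_conv)
    obtain e where e: "cond_kernel M F M (kid M) e"
      using ex_cond_kernel_kid[OF assms(1) F] by blast
    have dagger: "dagger_idem M e" by (rule dagger_idem_cond_kernel[OF M F e])
    have "one_sided_conv M M le es e"
      by (rule decreasing_net_conv[OF M assms(2) es _ F sets_F e])
        (use dec inv_mono[OF es es] in blast)
    then have "two_sided_conv M M le es e" by (rule two_sided_conv_dagger[OF _ es dagger])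
    moreover have "idem_le M e (es i)" for i
      using sets_F by (intro idem_le_cond_kernel[OF M F sub[OF es] _ e ck[OF es]]) blast
    moreover have "idem_le M g e" if g: "dagger_idem M g" "\<forall>i. idem_le M g (es i)" for g
    proof (rule idem_le_cond_kernel[OF M sub[OF g(1)] F _ ck[OF g(1)] e])
      show "sets (invariant_algebra M g) \<subseteq> sets F"
        unfolding sets_F using inv_mono[OF g(1) es] g(2) by blast
    qed
    ultimately show "\<exists>e. dagger_idem M e \<and> (\<forall>i. idem_le M e (es i)) \<and>
          (\<forall>g. dagger_idem M g \<and> (\<forall>i. idem_le M g (es i)) \<longrightarrow> idem_le M g e) \<and>
          two_sided_conv M M le es e"
      using dagger by blast
  qed
qed

end
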